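(* Let $n\ge3$ and consider a generic arrangement of $n$ lines in the plane $\mathbb R^2$, given by $a_{1i}y_1+a_{2i}y_2=c_i$ for $i=1,\dots,n$, together with a generic cost vector $\mathbf b\in\mathbb R^2$. Then the average total curvature of the central path of this line arrangement, that is, the average over all bounded regions of the arrangement of the total curvature of the central curve in that region, is at most $2\pi$.
   Context: Generic means that the data $(a_{ji}),(c_i),\mathbf b$ lie outside a suitable proper algebraic subset of the parameter space. Regions are connected components of the complement of the lines. The central curve is the plane algebraic curve of degree $n-1$ with equation $$\sum_{i=1}^n(b_1a_{2i}-b_2a_{1i})\prod_{j\neq i}(a_{1j}y_1+a_{2j}y_2-c_j)=0;$$ in each bounded region $R$ it contains the central path $\lambda\mapsto\arg\min_{\mathbf y\in R}\bigl(\mathbf b^T\mathbf y-\lambda\sum_i\log|a_{1i}y_1+a_{2i}y_2-c_i|\bigr)$, $\lambda>0$. The total curvature of a (parametrized) curve $f$ is the arc length of its Gauss image $t\mapsto f'(t)/\|f'(t)\|$ in the unit circle. The central curve in the region $R$ is the part of the real central curve lying in $R$. *)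

theory Defs
  imports "HOL-Analysis.Analysis"
begin

definition algebraic_subset :: "'a::real_normed_vector set \<Rightarrow> bool" where
  "algebraic_subset Z \<longleftrightarrow>
     (\<exists>F. (\<forall>p\<in>F. real_polynomial_function p) \<and> Z = {x. \<forall>p\<in>F. p x = 0})"

definition generically :: "('a::real_normed_vector \<Rightarrow> bool) \<Rightarrow> bool" where
  "generically P \<longleftrightarrow> (\<exists>Z. algebraic_subset Z \<and> Z \<noteq> UNIV \<and> (\<forall>x. x \<notin> Z \<longrightarrow> P x))"

definition arc_length :: "(real \<Rightarrow> 'a::metric_space) \<Rightarrow> real set \<Rightarrow> ennreal" where
  "arc_length g I =
     (SUP (m, s) \<in> {(m :: nat, s :: nat \<Rightarrow> real). mono_on {..m} s \<and> s ` {..m} \<subseteq> I}.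
        \<Sum>k<m. ennreal (dist (g (s k)) (g (s (Suc k)))))"

text \<open>The Gauss image; recall that \<^term>\<open>sgn v\<close> is \<^term>\<open>v /\<^sub>R norm v\<close> for a vector \<open>v\<close>.\<close>

definition gauss_map :: "(real \<Rightarrow> real^2) \<Rightarrow> real \<Rightarrow> real^2" where
  "gauss_map f t = sgn (vector_derivative f (at t))"

definition total_curvature :: "(real \<Rightarrow> real^2) \<Rightarrow> real set \<Rightarrow> ennreal" where
  "total_curvature f I = arc_length (gauss_map f) I"

definition regular_parametrization :: "(real \<Rightarrow> real^2) \<Rightarrow> real set \<Rightarrow> (real^2) set \<Rightarrow> bool" where
  "regular_parametrization f I S \<longleftrightarrow>
     open I \<and> connected I \<and> f C1_differentiable_on I \<and>
     (\<forall>t\<in>I. vector_derivative f (at t) \<noteq> 0) \<and> inj_on f I \<and> f ` I = S"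

text \<open>
  For an embedded arc \<open>S\<close> the total curvature is the same for all regular parametrizations,
  so the supremum below is this common value. A set without a regular parametrization
  is given the value \<open>\<infinity>\<close>, so that an upper bound on the curvature is never vacuous.
\<close>

definition curve_total_curvature :: "(real^2) set \<Rightarrow> ennreal" where
  "curve_total_curvature S =
     (if \<exists>f I. regular_parametrization f I S
      then SUP (f, I) \<in> {(f, I). regular_parametrization f I S}. total_curvature f I
      else \<infinity>)"

text \<open>
  The coefficient matrix \<open>a\<close> has rows indexed by \<open>{1, 2}\<close> and columns indexed by the lines:
  \<open>a $ j $ i\<close> is the coefficient of \<open>y $ j\<close> in the equation of line \<open>i\<close>.
\<close>

definition affine_form :: "real^'n^2 \<Rightarrow> real^'n \<Rightarrow> 'n \<Rightarrow> real^2 \<Rightarrow> real" where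
  "affine_form a c i y = a $ 1 $ i * y $ 1 + a $ 2 $ i * y $ 2 - c $ i"

definition line :: "real^'n^2 \<Rightarrow> real^'n \<Rightarrow> 'n \<Rightarrow> (real^2) set" where
  "line a c i = {y. a $ 1 $ i * y $ 1 + a $ 2 $ i * y $ 2 = c $ i}"

definition regions :: "real^'n^2 \<Rightarrow> real^'n \<Rightarrow> (real^2) set set" where
  "regions a c = components (- (\<Union>i. line a c i))"

definition bounded_regions :: "real^'n^2 \<Rightarrow> real^'n \<Rightarrow> (real^2) set set" where
  "bounded_regions a c = {R \<in> regions a c. bounded R}"

definition central_curve :: "real^'n^2 \<Rightarrow> real^'n \<Rightarrow> real^2 \<Rightarrow> (real^2) set" where
  "central_curve a c b =
     {y. (\<Sum>i\<in>UNIV. (b $ 1 * a $ 2 $ i - b $ 2 * a $ 1 $ i) *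
            (\<Prod>j\<in>UNIV - {i}. affine_form a c j y)) = 0}"

definition average_total_curvature :: "real^'n^2 \<Rightarrow> real^'n \<Rightarrow> real^2 \<Rightarrow> ennreal" where
  "average_total_curvature a c b =
     (\<Sum>R\<in>bounded_regions a c. curve_total_curvature (central_curve a c b \<inter> R)) /
       of_nat (card (bounded_regions a c))"

text \<open>
  There are only finitely many regions, so the sum and the cardinality above are
  the intended ones.
\<close>

lemma finite_regions: "finite (regions (a :: real^'n::finite^2) c)"
proof -
  let ?X = "- (\<Union>i. line a c i)"
  let ?L = "affine_form a c"
  define sg where "sg = (\<lambda>R. {i. \<exists>y\<in>R. 0 < ?L i y})"
  define H where "H = (\<lambda>P. {y. \<forall>i. if i \<in> P then 0 < ?L i y else ?L i y < 0})"
  have lin: "?L i y = (\<chi> j. a $ j $ i) \<bullet> y - c $ i" for i y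
    by (simp add: affine_form_def inner_vec_def sum_2)
  have X: "y \<in> ?X \<longleftrightarrow> (\<forall>i. ?L i y \<noteq> 0)" for y
    by (auto simp: line_def affine_form_def)
  have HX: "H P \<subseteq> ?X" for P
  proof
    fix y assume "y \<in> H P"
    then have "?L i y \<noteq> 0" for i
      unfolding H_def by (cases "i \<in> P") (auto dest: spec[of _ i])
    then show "y \<in> ?X" using X by blast
  qed
  have conn: "connected (H P)" for P
  proof -
    have "H P = (\<Inter>i. {y. if i \<in> P then 0 < ?L i y else ?L i y < 0})"
      by (auto simp only: H_def)
    moreover have "convex {y. if i \<in> P then 0 < ?L i y else ?L i y < 0}" for i
      using convex_halfspace_gt[of "c $ i" "\<chi> j. a $ j $ i"]
        convex_halfspace_lt[of "\<chi> j. a $ j $ i" "c $ i"]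
      by (cases "i \<in> P") (simp_all add: lin)
    ultimately have "convex (H P)" by (simp only: convex_INT)
    then show ?thesis by (rule convex_connected)
  qed
  have RH: "R \<subseteq> H (sg R)" if R: "R \<in> components ?X" for R
  proof
    fix y assume y: "y \<in> R"
    have cR: "connected R" and RX: "R \<subseteq> ?X"
      by (rule in_components_connected[OF R], rule in_components_subset[OF R])
    have "?L i y < 0" if "i \<notin> sg R" for i
    proof -
      have "\<not> 0 < ?L i y" using that y by (auto simp: sg_def)
      moreover have "?L i y \<noteq> 0" using X[of y] RX y by blast
      ultimately show ?thesis by linarith
    qed
    moreover have "0 < ?L i y" if i: "i \<in> sg R" for i
    proof (rule ccontr)
      assume "\<not> 0 < ?L i y"
      from i obtain z where z: "z \<in> R" "0 < ?L i z" by (auto simp: sg_def)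
      have "connected (?L i ` R)"
        by (rule connected_continuous_image[OF _ cR]) (auto simp: affine_form_def intro!: continuous_intros)
      moreover have "?L i y \<in> ?L i ` R" "?L i z \<in> ?L i ` R" using y z by auto
      moreover have "?L i y \<le> 0" "0 \<le> ?L i z" using z \<open>\<not> 0 < ?L i y\<close> by linarith+
      ultimately have "0 \<in> ?L i ` R" unfolding connected_iff_interval by blast
      then obtain w where w: "w \<in> R" "?L i w = 0" by (metis imageE)
      with RX have "w \<in> ?X" by blast
      then have "?L i w \<noteq> 0" using X[of w] by blast
      with w show False by simp
    qed
    ultimately show "y \<in> H (sg R)" by (simp add: H_def)
  qed
  have "inj_on sg (components ?X)"
  proof (rule inj_onI)
    fix R S assume R: "R \<in> components ?X" and S: "S \<in> components ?X" and eq: "sg R = sg S"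
    have max: "H (sg T) \<subseteq> T" if T: "T \<in> components ?X" for T
    proof (rule components_maximal[OF T conn HX])
      show "T \<inter> H (sg T) \<noteq> {}"
        using RH[OF T] in_components_nonempty[OF T] by (simp add: Int_absorb2)
    qed
    show "R = S"
    proof (rule equalityI)
      show "R \<subseteq> S" using RH[OF R] max[OF S] unfolding eq by (rule subset_trans)
      show "S \<subseteq> R" using RH[OF S] max[OF R] unfolding eq by (rule subset_trans)
    qed
  qed
  moreover have "finite (sg ` components ?X)" by (rule finite)
  ultimately show ?thesis unfolding regions_def by (rule finite_imageD[rotated])
qed

end

theory Submission
  imports Defs "Jordan_Normal_Form.Determinant"
begin

text \<open>
  In orthonormal coordinates \<open>(t, s)\<close> with the \<open>t\<close>-axis along \<open>b\<close>, the lines are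
  \<open>s = m\<^sub>i t + k\<^sub>i\<close> and the central curve is \<open>F = \<Sum>\<^sub>i \<Prod>\<^sub>j\<^sub>\<noteq>\<^sub>i q\<^sub>j = 0\<close> with
  \<open>q\<^sub>i = s - m\<^sub>i t - k\<^sub>i\<close>. Inside a bounded region it is a graph \<open>s = \<sigma> t\<close>, so its total curvature
  is the variation of \<open>arctan \<sigma>'\<close>. For all but finitely many \<open>u\<close>, the condition \<open>\<sigma>' = u\<close> holds at
  no more than \<open>(n-1)(n-2)\<close> points of all regions together: such points are zeros, with multiplicity, of
  \<open>\<Prod> G\<^sub>u(t, s)\<close>, the product over the \<open>n-1\<close> real roots \<open>s\<close> of \<open>F(t, \<sqdot>)\<close> of
  \<open>G\<^sub>u = \<partial>\<^sub>t F + u \<partial>\<^sub>s F\<close>; this product is a polynomial in \<open>t\<close>, and of degree at most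
  \<open>(n-1)(n-2)\<close> by its growth. Integrating over the angles, the total curvatures sum up to at most
  \<open>\<pi>(n-1)(n-2)\<close>, while there are at least \<open>(n-1)(n-2)/2\<close> bounded regions.
\<close>

section \<open>Products over the roots of a polynomial\<close>

text \<open>In these coordinates \<open>F\<close> is the \<open>s\<close>-derivative of the product
  of all \<open>q i\<close>, because the weights of the central curve cancel the scale factors of
  the affine forms. On a level line of the cost (\<open>t\<close> constant) the curve thus consists
  of the critical points of that product. Rolle puts one between any two neighbouring lines: this is
  why all n-1 roots are real, and why a cell with lines below and above it carries exactly one
  branch.

  The same fact yields the degree. Up to sign \<open>G u\<close> is a combination of products of n-2
  of the \<open>q i\<close>. Between the lines every \<open>q i\<close> is O(|t|), so each of the
  n-1 factors of the product is O(|t|^(n-2)), and the degree is read off without intersection theory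
  at infinity.

  The obstacle is that the count is joint: several regions may have slope u over the same t. Hence
  zeros are counted with their order, and the arc lengths, each a supremum over partitions, are
  estimated for one simultaneous choice of partitions. The factor pi is the length of the range of
  arctan.\<close>

definition poly2 :: "real poly poly \<Rightarrow> real \<Rightarrow> real \<Rightarrow> real" where
  "poly2 p t s = poly (poly p [:s:]) t"

lemma poly2_simps [simp]:
  "poly2 0 t s = 0" "poly2 1 t s = 1"
  "poly2 (p + p') t s = poly2 p t s + poly2 p' t s"
  "poly2 (p * p') t s = poly2 p t s * poly2 p' t s"
  "poly2 (Polynomial.smult r p) t s = poly r t * poly2 p t s"
  "poly2 [:r, 1:] t s = poly r t + s"
  by (simp_all add: poly2_def)

lemma poly2_sum: "poly2 (sum f A) t s = (\<Sum>x\<in>A. poly2 (f x) t s)"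
  by (simp add: poly2_def poly_sum)

lemma poly2_prod: "poly2 (prod f A) t s = (\<Prod>x\<in>A. poly2 (f x) t s)"
  by (simp add: poly2_def poly_prod)

lemma poly2_altdef:
  assumes "degree r < d"
  shows "poly2 r t s = (\<Sum>l<d. poly (coeff r l) t * s ^ l)"
proof -
  have "poly r [:s:] = (\<Sum>l\<le>degree r. coeff r l * [:s:] ^ l)" by (rule poly_altdef)
  also have "\<dots> = (\<Sum>l<d. coeff r l * [:s:] ^ l)"
    by (rule sum.mono_neutral_left) (use assms in \<open>auto simp: coeff_eq_0\<close>)
  finally show ?thesis by (simp add: poly2_def poly_sum)
qed

text \<open>A kernel vector would be the coefficient list of a nonzero polynomial of degree below
  \<open>d\<close> that vanishes at the \<open>d\<close> distinct points \<open>x j\<close>.\<close>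

lemma Vandermonde_det_nonzero:
  fixes x :: "nat \<Rightarrow> real"
  assumes "inj_on x {..<d}"
  shows "Determinant.det (mat d d (\<lambda>(j, k). x j ^ k)) \<noteq> 0"
proof
  let ?X = "mat d d (\<lambda>(j, k). x j ^ k)"
  assume "Determinant.det ?X = 0"
  then obtain v where v: "v \<in> carrier_vec d" "v \<noteq> 0\<^sub>v d" "?X *\<^sub>v v = 0\<^sub>v d"
    using det_0_iff_vec_prod_zero[of ?X d] by auto
  define p where "p = (\<Sum>k<d. monom (vec_index v k) k)"
  have coeff: "coeff p k = (if k < d then vec_index v k else 0)" for k
    by (auto simp: p_def coeff_sum)
  have root: "poly p (x j) = 0" if "j < d" for j
  proof -
    have "vec_index (?X *\<^sub>v v) j = (\<Sum>k<d. x j ^ k * vec_index v k)"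
      using v(1) that by (simp add: scalar_prod_def atLeast0LessThan)
    moreover have "\<dots> = poly p (x j)"
      by (simp add: p_def poly_sum poly_monom mult.commute)
    ultimately show ?thesis using v(3) that by simp
  qed
  have "p \<noteq> 0"
  proof
    assume "p = 0"
    then have "vec_index v k = 0" if "k < d" for k using coeff[of k] that by simp
    with v(1,2) show False by (auto intro!: eq_vecI)
  qed
  have "d = card (x ` {..<d})" using assms by (simp add: card_image)
  also have "\<dots> \<le> card {y. poly p y = 0}"
    by (rule card_mono) (use root \<open>p \<noteq> 0\<close> poly_roots_finite in auto)
  also have "\<dots> \<le> degree p" by (rule card_poly_roots_bound[OF \<open>p \<noteq> 0\<close>])
  finally have "d \<le> degree p" .
  then have "lead_coeff p = 0" using coeff[of "degree p"] by auto
  then show False using \<open>p \<noteq> 0\<close> by simp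
qed

text \<open>
  Multiplication by \<open>G\<close> on polynomials modulo \<open>F\<close> has a matrix with entries polynomial in \<open>t\<close>;
  a Vandermonde matrix diagonalizes it, so \<open>D\<close> is its determinant.
\<close>

lemma ex_poly_prod_over_roots:
  fixes F G :: "real poly poly"
  assumes lead: "lead_coeff F = [:c:]" "c \<noteq> 0" and d: "degree F = d" "0 < d"
  obtains D :: "real poly" where
    "\<And>t S. card S = d \<Longrightarrow> (\<And>s. s \<in> S \<Longrightarrow> poly2 F t s = 0) \<Longrightarrow> poly D t = (\<Prod>s\<in>S. poly2 G t s)"
proof -
  have F0: "F \<noteq> 0" using d by auto
  have "\<exists>r. degree r < d \<and> (\<forall>t s. poly2 F t s = 0 \<longrightarrow> poly2 r t s = s ^ k * poly2 G t s)" for k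
  proof -
    define H where "H = monom 1 k * G"
    \<comment> \<open>Column \<open>k\<close> of the multiplication matrix is the remainder of s^k *
      G. Pseudo-division scales by a power of the leading coefficient; as this is the constant
      \<open>c\<close>, the factor can be divided out again and the entries stay polynomial in
      \<open>t\<close>.\<close>
    obtain Q R where QR: "pseudo_divmod H F = (Q, R)" by fastforce
    define e where "e = Suc (degree H) - degree F"
    have eq: "Polynomial.smult ([:c:] ^ e) H = F * Q + R" and dR: "R = 0 \<or> degree R < degree F"
      using pseudo_divmod[OF F0 QR] lead by (simp_all add: e_def)
    have H: "poly2 H t s = s ^ k * poly2 G t s" for t s
      by (simp add: H_def) (simp add: poly2_def poly_monom)
    have "poly2 (Polynomial.smult [:1 / c ^ e:] R) t s = s ^ k * poly2 G t s" if "poly2 F t s = 0" for t s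
    proof -
      have "poly2 (Polynomial.smult ([:c:] ^ e) H) t s = poly2 R t s"
        unfolding eq using that by simp
      then show ?thesis using lead(2) by (simp add: H field_simps)
    qed
    moreover have "degree (Polynomial.smult [:1 / c ^ e:] R) < d" using dR d lead by auto
    ultimately show ?thesis by blast
  qed
  then obtain r where r: "\<And>k. degree (r k) < d"
    "\<And>k t s. poly2 F t s = 0 \<Longrightarrow> poly2 (r k) t s = s ^ k * poly2 G t s" by metis
  define C where "C = mat d d (\<lambda>(l, k). coeff (r k) l)"
  show thesis
  proof (rule that[of "Determinant.det C"])
    fix t :: real and S
    assume S: "card S = d" "\<And>s. s \<in> S \<Longrightarrow> poly2 F t s = 0"
    then have "finite S" using d card_ge_0_finite by metis
    obtain x where x: "bij_betw x {..<d} S"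
      using ex_bij_betw_nat_finite[OF \<open>finite S\<close>] S by (auto simp: atLeast0LessThan)
    then have inj: "inj_on x {..<d}" and xS: "\<And>j. j < d \<Longrightarrow> x j \<in> S"
      by (auto simp: bij_betw_def)
    interpret ev: comm_ring_hom "\<lambda>p :: real poly. poly p t" by standard auto
    define X where "X = mat d d (\<lambda>(j, k). x j ^ k)"
    define \<Gamma> where "\<Gamma> = mat d d (\<lambda>(j, k). if j = k then poly2 G t (x j) else 0)"
    define Ct where "Ct = map_mat (\<lambda>p. poly p t) C"
    have car: "X \<in> carrier_mat d d" "\<Gamma> \<in> carrier_mat d d" "Ct \<in> carrier_mat d d"
      by (auto simp: X_def \<Gamma>_def Ct_def C_def)
    \<comment> \<open>Entry (j, k) of either side is x_j^k times the value of \<open>G\<close> at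
      the root \<open>x j\<close>: \<open>X\<close> evaluates polynomials at the roots, where a
      remainder modulo \<open>F\<close> agrees with the polynomial it came from.\<close>
    have "X * Ct = \<Gamma> * X"
    proof (rule eq_matI)
      fix j k assume "j < dim_row (\<Gamma> * X)" "k < dim_col (\<Gamma> * X)"
      then have jk: "j < d" "k < d" using car by auto
      have "(X * Ct) $$ (j, k) = (\<Sum>l<d. x j ^ l * poly (coeff (r k) l) t)"
        using jk by (simp add: X_def Ct_def C_def scalar_prod_def atLeast0LessThan)
      also have "\<dots> = poly2 (r k) t (x j)"
        by (simp add: poly2_altdef[OF r(1)] mult.commute)
      also have "\<dots> = x j ^ k * poly2 G t (x j)" using r(2) S(2) xS jk by blast
      also have "\<dots> = (\<Sum>l<d. (if j = l then poly2 G t (x j) else 0) * x l ^ k)"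
        using jk by (simp add: if_distrib[of "\<lambda>u. u * _"] sum.delta cong: if_cong)
      also have "\<dots> = (\<Gamma> * X) $$ (j, k)"
        using jk by (simp add: X_def \<Gamma>_def scalar_prod_def atLeast0LessThan)
      finally show "(X * Ct) $$ (j, k) = (\<Gamma> * X) $$ (j, k)" .
    qed (use car in auto)
    then have "Determinant.det X * Determinant.det Ct = Determinant.det \<Gamma> * Determinant.det X"
      using car by (metis det_mult)
    moreover have "Determinant.det X \<noteq> 0"
      unfolding X_def by (rule Vandermonde_det_nonzero[OF inj])
    moreover have "Determinant.det \<Gamma> = (\<Prod>j<d. poly2 G t (x j))"
    proof -
      have "upper_triangular \<Gamma>" by (auto simp: \<Gamma>_def)
      then have "Determinant.det \<Gamma> = prod_list (diag_mat \<Gamma>)"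
        using det_upper_triangular car by blast
      also have "\<dots> = (\<Prod>j<d. poly2 G t (x j))"
        by (simp add: prod_list_diag_prod \<Gamma>_def atLeast0LessThan)
      finally show ?thesis .
    qed
    moreover have "(\<Prod>j<d. poly2 G t (x j)) = (\<Prod>s\<in>S. poly2 G t s)"
      by (rule prod.reindex_bij_betw[OF x])
    moreover have "Determinant.det Ct = poly (Determinant.det C) t"
      by (simp add: Ct_def)
    ultimately show "poly (Determinant.det C) t = (\<Prod>s\<in>S. poly2 G t s)" by simp
  qed
qed

section \<open>The central curve and its polar\<close>

lemma prod_remove1_eq_divide:
  fixes f :: "'a::finite \<Rightarrow> real"
  assumes "f i \<noteq> 0"
  shows "(\<Prod>j\<in>UNIV - {i}. f j) = (\<Prod>j\<in>UNIV. f j) / f i"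
  using prod.remove[of UNIV i f] assms by simp

lemma prod_remove2_eq_divide:
  fixes f :: "'a::finite \<Rightarrow> real"
  assumes "f i \<noteq> 0" "f j \<noteq> 0" "i \<noteq> j"
  shows "(\<Prod>l\<in>UNIV - {i, j}. f l) = (\<Prod>l\<in>UNIV. f l) / (f i * f j)"
proof -
  have "(\<Prod>l\<in>UNIV - {i}. f l) = f j * (\<Prod>l\<in>UNIV - {i} - {j}. f l)"
    by (rule prod.remove) (use assms in auto)
  moreover have "UNIV - {i} - {j} = UNIV - {i, j}" by auto
  ultimately show ?thesis using prod_remove1_eq_divide[of f i] assms by (simp add: field_simps)
qed

locale line_family =
  fixes m k :: "'n::finite \<Rightarrow> real"
  assumes inj_m: "inj m" and card_ge: "CARD('n) \<ge> 3"
begin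

definition q :: "'n \<Rightarrow> real \<Rightarrow> real \<Rightarrow> real" where
  "q i t s = s - m i * t - k i"

definition Q :: "'n \<Rightarrow> real poly poly" where
  "Q i = [:[:- k i, - m i:], 1:]"

definition F :: "real poly poly" where
  "F = (\<Sum>i\<in>UNIV. \<Prod>j\<in>UNIV - {i}. Q j)"

text \<open>The derivative of \<open>F\<close> in the direction (1, u): along it \<open>q j\<close>
  grows at rate \<open>u - m j\<close>, and \<open>j\<close> is the factor that the product rule
  differentiates.\<close>

definition G :: "real \<Rightarrow> real poly poly" where
  "G u = (\<Sum>j\<in>UNIV. Polynomial.smult [:u - m j:] (\<Sum>i\<in>UNIV - {j}. \<Prod>l\<in>UNIV - {i, j}. Q l))"

lemma poly2_Q [simp]: "poly2 (Q i) t s = q i t s"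
  by (simp add: Q_def q_def algebra_simps)

lemma poly2_F: "poly2 F t s = (\<Sum>i\<in>UNIV. \<Prod>j\<in>UNIV - {i}. q j t s)"
  by (simp add: F_def poly2_sum poly2_prod)

lemma poly2_G:
  "poly2 (G u) t s = (\<Sum>j\<in>UNIV. (u - m j) * (\<Sum>i\<in>UNIV - {j}. \<Prod>l\<in>UNIV - {i, j}. q l t s))"
  by (simp add: G_def poly2_sum poly2_prod)

text \<open>Every summand is monic in \<open>s\<close> of the same degree, so the leading terms add
  up without cancellation. The leading coefficient being constant in \<open>t\<close> is what keeps
  remainders modulo \<open>F\<close> polynomial.\<close>

lemma degree_F: "degree F = CARD('n) - 1"
  and lead_coeff_F: "lead_coeff F = [:real CARD('n):]"
proof -
  have deg: "degree (\<Prod>j\<in>UNIV - {i}. Q j) = CARD('n) - 1" for i :: 'n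
    by (subst degree_prod_eq_sum_degree) (auto simp: Q_def card_Diff_singleton)
  have lc: "lead_coeff (\<Prod>j\<in>UNIV - {i}. Q j) = 1" for i :: 'n
    by (simp add: lead_coeff_prod Q_def)
  have c: "coeff F (CARD('n) - 1) = of_nat CARD('n)"
  proof -
    have "coeff (\<Prod>j\<in>UNIV - {i}. Q j) (CARD('n) - 1) = 1" for i using lc[of i] deg[of i] by metis
    then show ?thesis by (simp add: F_def coeff_sum)
  qed
  show "degree F = CARD('n) - 1"
  proof (rule antisym)
    show "degree F \<le> CARD('n) - 1" unfolding F_def by (rule degree_sum_le) (simp_all add: deg)
    show "CARD('n) - 1 \<le> degree F" by (rule le_degree) (simp only: c, simp)
  qed
  then show "lead_coeff F = [:real CARD('n):]" using c by (simp add: of_nat_poly)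
qed

lemma F_eq:
  assumes "\<And>i. q i t s \<noteq> 0"
  shows "poly2 F t s = (\<Prod>i\<in>UNIV. q i t s) * (\<Sum>i\<in>UNIV. 1 / q i t s)"
  unfolding poly2_F sum_distrib_left
  by (rule sum.cong) (simp_all add: prod_remove1_eq_divide assms)

lemma F_eq_0_iff:
  assumes "\<And>i. q i t s \<noteq> 0"
  shows "poly2 F t s = 0 \<longleftrightarrow> (\<Sum>i\<in>UNIV. 1 / q i t s) = 0"
  using assms by (simp add: F_eq)

text \<open>On the curve the reciprocals of the \<open>q i\<close> sum to zero, so those with
  \<open>i\<close> different from \<open>j\<close> sum to -1 / q_j. This collapses the double sum in
  \<open>G u\<close> to a single sum over squares.\<close>

lemma G_eq:
  assumes q: "\<And>i. q i t s \<noteq> 0" and F: "poly2 F t s = 0"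
  shows "poly2 (G u) t s = - (\<Prod>i\<in>UNIV. q i t s) * (\<Sum>j\<in>UNIV. (u - m j) / (q j t s)\<^sup>2)"
proof -
  have "(\<Sum>i\<in>UNIV - {j}. \<Prod>l\<in>UNIV - {i, j}. q l t s) = - (\<Prod>i\<in>UNIV. q i t s) / (q j t s)\<^sup>2" for j
  proof -
    have "(\<Sum>i\<in>UNIV - {j}. \<Prod>l\<in>UNIV - {i, j}. q l t s)
        = (\<Sum>i\<in>UNIV - {j}. (\<Prod>i\<in>UNIV. q i t s) / q j t s * (1 / q i t s))"
      by (rule sum.cong) (auto simp: prod_remove2_eq_divide q)
    also have "\<dots> = (\<Prod>i\<in>UNIV. q i t s) / q j t s * (\<Sum>i\<in>UNIV - {j}. 1 / q i t s)"
      by (rule sum_distrib_left[symmetric])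
    also have "(\<Sum>i\<in>UNIV - {j}. 1 / q i t s) = - 1 / q j t s"
      using sum.remove[of UNIV j "\<lambda>i. 1 / q i t s"] F F_eq_0_iff[OF q] by simp
    finally show ?thesis by (simp add: power2_eq_square)
  qed
  then show ?thesis unfolding poly2_G
    by (simp add: sum_distrib_left sum_negf mult_ac)
qed

lemma finite_crossings: "finite {t. \<not> inj (\<lambda>i. m i * t + k i)}"
proof (rule finite_subset)
  show "{t. \<not> inj (\<lambda>i. m i * t + k i)} \<subseteq> (\<lambda>(i, j). (k j - k i) / (m i - m j)) ` UNIV"
  proof
    fix t assume "t \<in> {t. \<not> inj (\<lambda>i. m i * t + k i)}"
    then obtain i j where ij: "i \<noteq> j" "m i * t + k i = m j * t + k j" by (auto simp: inj_def)
    then have "m i - m j \<noteq> 0" using inj_m by (auto simp: inj_def)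
    then have "t = (k j - k i) / (m i - m j)" using ij by (simp add: field_simps)
    then show "t \<in> (\<lambda>(i, j). (k j - k i) / (m i - m j)) ` UNIV" by (auto intro: rev_image_eqI)
  qed
qed simp

text \<open>Away from the crossings, F(t, .) is the derivative of a polynomial with n distinct real
  roots. Rolle gives a zero in each of the n-1 gaps, and the degree leaves room for no others. The
  sign conclusions record that every zero has a line strictly below it and one strictly above
  it.\<close>

lemma roots_F:
  assumes inj: "inj (\<lambda>i. m i * t + k i)"
  obtains S where "S = {s. poly2 F t s = 0}" "finite S" "card S = CARD('n) - 1"
    "\<And>s. s \<in> S \<Longrightarrow> \<exists>i. q i t s > 0" "\<And>s. s \<in> S \<Longrightarrow> \<exists>i. q i t s < 0"
proof -
  define x where "x i = m i * t + k i" for i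
  have q: "q i t s = s - x i" for i s by (simp add: q_def x_def)
  define p where "p = (\<Prod>i\<in>UNIV. [:- x i, 1:])"
  have F: "poly2 F t s = poly (pderiv p) s" for s
    by (simp add: p_def pderiv_prod pderiv_pCons poly_sum poly_prod poly2_F q)
  have "degree p = CARD('n)"
    unfolding p_def by (subst degree_prod_eq_sum_degree) auto
  then have dp: "degree (pderiv p) = CARD('n) - 1" by (simp add: degree_pderiv)
  then have p0: "pderiv p \<noteq> 0" using card_ge by auto
  define A where "A = range x"
  have A: "finite A" "card A = CARD('n)" using inj by (auto simp: A_def x_def card_image)
  then have A0: "A \<noteq> {}" by (auto simp: A_def)
  \<comment> \<open>The next height above \<open>a\<close>. Gaps are indexed by their lower ends,
    hence by all heights but \<open>Max A\<close>.\<close>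
  define nx where "nx a = Min {b \<in> A. a < b}" for a
  have nx: "nx a \<in> A" "a < nx a" "\<And>b. b \<in> A \<Longrightarrow> a < b \<Longrightarrow> nx a \<le> b"
    if "a \<in> A - {Max A}" for a
  proof -
    have "Max A \<in> {b \<in> A. a < b}" using that A A0 by (auto simp: less_le)
    then have "nx a \<in> {b \<in> A. a < b}" unfolding nx_def using A by (intro Min_in) auto
    then show "nx a \<in> A" "a < nx a" by auto
    show "nx a \<le> b" if "b \<in> A" "a < b" for b
      unfolding nx_def by (rule Min_le) (use A that in auto)
  qed
  have pA: "poly p a = 0" if "a \<in> A" for a
    using that by (auto simp: p_def A_def poly_prod)
  have "\<exists>z. a < z \<and> z < nx a \<and> poly (pderiv p) z = 0" if a: "a \<in> A - {Max A}" for a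
    using poly_MVT[OF nx(2)[OF a], of p] pA[OF nx(1)[OF a]] pA[of a] nx(2)[OF a] a by auto
  then obtain z where z: "\<And>a. a \<in> A - {Max A} \<Longrightarrow> a < z a \<and> z a < nx a \<and> poly (pderiv p) (z a) = 0"
    by metis
  have less: "z a < z b" if "a \<in> A - {Max A}" "b \<in> A - {Max A}" "a < b" for a b
    using z[OF that(1)] z[OF that(2)] nx(3)[OF that(1), of b] that by auto
  have inj_z: "inj_on z (A - {Max A})"
    by (rule inj_onI) (use less in \<open>metis less_irrefl linorder_less_linear\<close>)
  define S where "S = {s. poly2 F t s = 0}"
  have fin: "finite S" unfolding S_def F by (rule poly_roots_finite[OF p0])
  have sub: "z ` (A - {Max A}) \<subseteq> S" using z by (auto simp: S_def F)
  have cz: "card (z ` (A - {Max A})) = CARD('n) - 1"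
    using inj_z A A0 by (simp add: card_image)
  have "card S \<le> CARD('n) - 1"
    unfolding S_def F using card_poly_roots_bound[OF p0] dp by simp
  then have eq: "z ` (A - {Max A}) = S"
    using card_seteq[OF fin sub] cz by simp
  show thesis
  proof (rule that[of S])
    show "card S = CARD('n) - 1" using eq cz by simp
    show "\<exists>i. q i t s > 0" if "s \<in> S" for s
      using that z unfolding eq[symmetric] by (force simp: q A_def)
    show "\<exists>i. q i t s < 0" if "s \<in> S" for s
      using that z nx(1) unfolding eq[symmetric] by (force simp: q A_def)
  qed (fact S_def fin)+
qed

text \<open>A difference of two \<open>q\<close>s does not involve \<open>s\<close> and is O(1 +
  |t|). One positive and one negative value trap every \<open>q l\<close> between two such
  differences.\<close>

lemma q_bound:
  obtains B where "B \<ge> 0" "\<And>t s l. \<exists>i. q i t s > 0 \<Longrightarrow> \<exists>i. q i t s < 0 \<Longrightarrow> \<bar>q l t s\<bar> \<le> B * (1 + \<bar>t\<bar>)"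
proof -
  define B0 where "B0 = (\<Sum>i\<in>UNIV. \<bar>m i\<bar> + \<bar>k i\<bar>)"
  have B0: "\<bar>m i\<bar> + \<bar>k i\<bar> \<le> B0" for i
    unfolding B0_def by (rule member_le_sum) auto
  have diff: "\<bar>q i t s - q j t s\<bar> \<le> 2 * B0 * (1 + \<bar>t\<bar>)" for i j t s
  proof -
    have one: "\<bar>m i * t + k i\<bar> \<le> B0 * (1 + \<bar>t\<bar>)" for i
    proof -
      have "\<bar>m i * t + k i\<bar> \<le> \<bar>m i\<bar> * \<bar>t\<bar> + \<bar>k i\<bar>"
        by (metis abs_mult abs_triangle_ineq)
      also have "\<dots> \<le> (\<bar>m i\<bar> + \<bar>k i\<bar>) * (1 + \<bar>t\<bar>)" by (simp add: algebra_simps)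
      also have "\<dots> \<le> B0 * (1 + \<bar>t\<bar>)" by (rule mult_right_mono[OF B0]) simp
      finally show ?thesis .
    qed
    have "q i t s - q j t s = (m j * t + k j) - (m i * t + k i)" by (simp add: q_def)
    then show ?thesis using one[of i] one[of j] by linarith
  qed
  show thesis
  proof (rule that[of "2 * B0"])
    show "2 * B0 \<ge> 0" by (simp add: B0_def sum_nonneg)
    fix t s l assume "\<exists>i. q i t s > 0" "\<exists>i. q i t s < 0"
    then obtain i j where "q i t s > 0" "q j t s < 0" by blast
    then show "\<bar>q l t s\<bar> \<le> 2 * B0 * (1 + \<bar>t\<bar>)"
      using diff[of l t s i] diff[of l t s j] by linarith
  qed
qed

text \<open>Each term of \<open>G u\<close> contains n-2 of the \<open>q l\<close>, all of linear
  growth between the lines. The lower bound 1 on \<open>K\<close> serves later, when a power of the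
  bound is enlarged to one with a larger exponent.\<close>

lemma G_bound:
  obtains K where "K \<ge> 1"
    "\<And>t s. \<exists>i. q i t s > 0 \<Longrightarrow> \<exists>i. q i t s < 0 \<Longrightarrow> \<bar>poly2 (G u) t s\<bar> \<le> K * (1 + \<bar>t\<bar>) ^ (CARD('n) - 2)"
proof -
  obtain B where B: "B \<ge> 0"
    "\<And>t s l. \<exists>i. q i t s > 0 \<Longrightarrow> \<exists>i. q i t s < 0 \<Longrightarrow> \<bar>q l t s\<bar> \<le> B * (1 + \<bar>t\<bar>)"
    using q_bound by blast
  define K where "K = (\<Sum>j\<in>UNIV. \<bar>u - m j\<bar> * (\<Sum>i\<in>UNIV - {j}. B ^ (CARD('n) - 2)))"
  have "\<bar>poly2 (G u) t s\<bar> \<le> K * (1 + \<bar>t\<bar>) ^ (CARD('n) - 2)"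
    if st: "\<exists>i. q i t s > 0" "\<exists>i. q i t s < 0" for t s
  proof -
    have p: "\<bar>\<Prod>l\<in>UNIV - {i, j}. q l t s\<bar> \<le> B ^ (CARD('n) - 2) * (1 + \<bar>t\<bar>) ^ (CARD('n) - 2)"
      if "i \<noteq> j" for i j
    proof -
      have "\<bar>\<Prod>l\<in>UNIV - {i, j}. q l t s\<bar> \<le> (\<Prod>l\<in>UNIV - {i, j}. B * (1 + \<bar>t\<bar>))"
        unfolding abs_prod by (rule prod_mono) (use B(2)[OF st] in auto)
      also have "\<dots> = (B * (1 + \<bar>t\<bar>)) ^ (CARD('n) - 2)"
        using that by (simp add: card_Diff_subset numeral_2_eq_2)
      finally show ?thesis by (simp add: power_mult_distrib)
    qed
    have "\<bar>poly2 (G u) t s\<bar>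
        \<le> (\<Sum>j\<in>UNIV. \<bar>u - m j\<bar> * (\<Sum>i\<in>UNIV - {j}. \<bar>\<Prod>l\<in>UNIV - {i, j}. q l t s\<bar>))"
      unfolding poly2_G
      by (rule order_trans[OF sum_abs], rule sum_mono) (simp add: abs_mult mult_left_mono)
    also have "\<dots> \<le> (\<Sum>j\<in>UNIV. \<bar>u - m j\<bar> * (\<Sum>i\<in>UNIV - {j}. B ^ (CARD('n) - 2) * (1 + \<bar>t\<bar>) ^ (CARD('n) - 2)))"
      by (intro sum_mono mult_left_mono p) auto
    also have "\<dots> = K * (1 + \<bar>t\<bar>) ^ (CARD('n) - 2)"
      unfolding K_def sum_distrib_right by (simp add: mult_ac sum_distrib_left)
    finally show ?thesis .
  qed
  then have max_K: "\<bar>poly2 (G u) t s\<bar> \<le> max 1 K * (1 + \<bar>t\<bar>) ^ (CARD('n) - 2)"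
    if "\<exists>i. q i t s > 0" "\<exists>i. q i t s < 0" for t s
    by (rule order_trans[OF _ mult_right_mono]) (use that in auto)
  show thesis by (rule that[OF _ max_K]) auto
qed

end

section \<open>The arc in a cell\<close>

context line_family
begin

text \<open>Regions are encoded by sign patterns: \<open>P\<close> is the set of lines that pass
  below the point. A pattern realized by no point gives an empty cell.\<close>

definition cell :: "'n set \<Rightarrow> real \<Rightarrow> real \<Rightarrow> bool" where
  "cell P t s \<longleftrightarrow> (\<forall>i. if i \<in> P then q i t s > 0 else q i t s < 0)"

lemma cell_pos: "cell P t s \<Longrightarrow> i \<in> P \<Longrightarrow> q i t s > 0"
  and cell_neg: "cell P t s \<Longrightarrow> i \<notin> P \<Longrightarrow> q i t s < 0"
  unfolding cell_def by (metis (full_types))+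

lemma cell_nonzero: "cell P t s \<Longrightarrow> q i t s \<noteq> 0"
  using cell_pos cell_neg by (metis less_irrefl)

lemma cell_mult_pos: "cell P t s \<Longrightarrow> cell P t' s' \<Longrightarrow> q i t s * q i t' s' > 0"
  using cell_pos cell_neg by (cases "i \<in> P") (auto intro: mult_neg_neg)

lemma cell_eq_positive: "cell P t s \<Longrightarrow> P = {i. q i t s > 0}"
  using cell_pos cell_neg by (metis (mono_tags, lifting) Collect_mem_eq less_asym mem_Collect_eq subsetI subset_antisym)

lemma cell_inj: "cell P t s \<Longrightarrow> cell P' t s \<Longrightarrow> P = P'"
  using cell_eq_positive by metis

text \<open>The vectors \<open>e1\<close>, \<open>e2\<close> are arbitrary so that this serves both
  the plane of pairs (t, s), from which \<open>J\<close> is projected, and the rotated basis of the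
  original plane.\<close>

lemma
  fixes e1 e2 :: "'v::real_inner"
  shows open_cell: "open {y. cell P (y \<bullet> e1) (y \<bullet> e2)}"
    and convex_cell: "convex {y. cell P (y \<bullet> e1) (y \<bullet> e2)}"
proof -
  have q: "q i (y \<bullet> e1) (y \<bullet> e2) = (e2 - m i *\<^sub>R e1) \<bullet> y - k i" for i y
    by (simp add: q_def inner_diff_left) (simp add: inner_commute)
  have eq: "{y. cell P (y \<bullet> e1) (y \<bullet> e2)}
      = (\<Inter>i. if i \<in> P then {y. (e2 - m i *\<^sub>R e1) \<bullet> y > k i} else {y. (e2 - m i *\<^sub>R e1) \<bullet> y < k i})"
    by (auto simp: cell_def q split: if_splits)
  show "open {y. cell P (y \<bullet> e1) (y \<bullet> e2)}"
    unfolding eq by (intro open_INT) (auto intro: open_halfspace_gt open_halfspace_lt)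
  show "convex {y. cell P (y \<bullet> e1) (y \<bullet> e2)}"
    unfolding eq by (intro convex_INT) (auto intro: convex_halfspace_gt convex_halfspace_lt)
qed

definition J :: "'n set \<Rightarrow> real set" where
  "J P = {t. \<exists>s. cell P t s}"

lemma J_eq_image: "J P = fst ` {y :: real \<times> real. cell P (y \<bullet> (1, 0)) (y \<bullet> (0, 1))}"
  by (force simp: J_def image_iff)

lemma open_J: "open (J P)"
  unfolding J_eq_image by (rule open_image_fst[OF open_cell])

lemma connected_J: "connected (J P)"
  unfolding J_eq_image
  by (rule connected_continuous_image) (auto intro!: continuous_intros convex_connected convex_cell)

text \<open>Both ends of the vertical section of the cell lie on lines, so the product of all
  \<open>q i\<close> vanishes there and Rolle applies. A line below and a line above make the
  section a bounded interval.\<close>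

lemma ex_critical:
  assumes P: "P \<noteq> {}" "P \<noteq> UNIV" and t: "t \<in> J P"
  shows "\<exists>s. cell P t s \<and> poly2 F t s = 0"
proof -
  define x where "x i = m i * t + k i" for i
  have q: "q i t s = s - x i" for i s by (simp add: q_def x_def)
  define lo hi where "lo = Max (x ` P)" and "hi = Min (x ` (- P))"
  have cell: "cell P t s \<longleftrightarrow> lo < s \<and> s < hi" for s
  proof -
    have "- P \<noteq> {}" using P by auto
    then have "lo < s \<longleftrightarrow> (\<forall>i\<in>P. x i < s)" "s < hi \<longleftrightarrow> (\<forall>i\<in>-P. s < x i)"
      using P by (auto simp: lo_def hi_def)
    then show ?thesis by (auto simp: cell_def q)
  qed
  obtain s0 where "cell P t s0" using t by (auto simp: J_def)
  then have "lo < hi" using cell by auto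
  define p where "p = (\<Prod>i\<in>UNIV. [:- x i, 1:])"
  have F: "poly2 F t s = poly (pderiv p) s" for s
    by (simp add: p_def pderiv_prod pderiv_pCons poly_sum poly_prod poly2_F q)
  have px: "poly p (x i) = 0" for i by (auto simp: p_def poly_prod)
  have "lo \<in> x ` P" unfolding lo_def by (rule Max_in) (use P in auto)
  moreover have "hi \<in> x ` (- P)" unfolding hi_def by (rule Min_in) (use P in auto)
  ultimately have "poly p lo = 0" "poly p hi = 0" using px by auto
  then obtain s where "lo < s" "s < hi" "poly (pderiv p) s = 0"
    using poly_MVT[OF \<open>lo < hi\<close>, of p] \<open>lo < hi\<close> by auto
  then show ?thesis using cell F by auto
qed

text \<open>
  The difference quotient along the central curve is a weighted mean of the slopes of the lines;
  this gives uniqueness (\<open>t' = t\<close>), continuity and the derivative at once.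
\<close>

lemma critical_difference:
  assumes "cell P t s" "cell P t' s'" "poly2 F t s = 0" "poly2 F t' s' = 0"
  shows "(s' - s) * (\<Sum>i\<in>UNIV. 1 / (q i t s * q i t' s')) = (t' - t) * (\<Sum>i\<in>UNIV. m i / (q i t s * q i t' s'))"
proof -
  note nz = cell_nonzero[OF assms(1)] cell_nonzero[OF assms(2)]
  have "0 = (\<Sum>i\<in>UNIV. 1 / q i t s - 1 / q i t' s')"
    using assms F_eq_0_iff[of t s] F_eq_0_iff[of t' s'] nz by (simp add: sum_subtractf)
  also have "\<dots> = (\<Sum>i\<in>UNIV. (s' - s) * (1 / (q i t s * q i t' s')) - (t' - t) * (m i / (q i t s * q i t' s')))"
  proof (rule sum.cong)
    fix i
    have "1 / q i t s - 1 / q i t' s' = (q i t' s' - q i t s) / (q i t s * q i t' s')"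
      using nz by (simp add: field_simps)
    also have "q i t' s' - q i t s = (s' - s) - (t' - t) * m i" by (simp add: q_def algebra_simps)
    finally show "1 / q i t s - 1 / q i t' s'
        = (s' - s) * (1 / (q i t s * q i t' s')) - (t' - t) * (m i / (q i t s * q i t' s'))"
      by (simp add: diff_divide_distrib)
  qed simp
  finally show ?thesis by (simp add: sum_subtractf sum_distrib_left)
qed

lemma sum_weights_pos:
  "cell P t s \<Longrightarrow> cell P t' s' \<Longrightarrow> (\<Sum>i\<in>UNIV. 1 / (q i t s * q i t' s')) > 0"
  using cell_mult_pos by (intro sum_pos) auto

section \<open>The central curve in a cell as the graph of a differentiable function\<close>

definition \<sigma> :: "'n set \<Rightarrow> real \<Rightarrow> real" where
  "\<sigma> P t = (THE s. cell P t s \<and> poly2 F t s = 0)"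

text \<open>Comes from implicit differentiation of the equation that the 1 / q_i sum to zero: the
  mean of the line slopes with weights 1 / q_i^2.\<close>

definition slope :: "'n set \<Rightarrow> real \<Rightarrow> real" where
  "slope P t = (\<Sum>i\<in>UNIV. m i / (q i t (\<sigma> P t))\<^sup>2) / (\<Sum>i\<in>UNIV. 1 / (q i t (\<sigma> P t))\<^sup>2)"

context
  fixes P :: "'n set"
  assumes P: "P \<noteq> {}" "P \<noteq> UNIV"
begin

lemma sigma:
  assumes "t \<in> J P"
  shows sigma_cell: "cell P t (\<sigma> P t)" and sigma_F: "poly2 F t (\<sigma> P t) = 0"
    and sigma_unique: "\<And>s. cell P t s \<Longrightarrow> poly2 F t s = 0 \<Longrightarrow> s = \<sigma> P t"
proof -
  have un: "s = s'" if "cell P t s" "poly2 F t s = 0" "cell P t s'" "poly2 F t s' = 0" for s s'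
    using critical_difference[of P t s t s'] sum_weights_pos[of P t s t s'] that by auto
  then have "\<exists>!s. cell P t s \<and> poly2 F t s = 0"
    using ex_critical[OF P assms] by blast
  from theI'[OF this] show *: "cell P t (\<sigma> P t)" "poly2 F t (\<sigma> P t) = 0"
    by (simp_all add: \<sigma>_def)
  show "s = \<sigma> P t" if "cell P t s" "poly2 F t s = 0" for s
    using un[OF that *] .
qed

lemma sigma_Lipschitz:
  assumes "t \<in> J P" "t' \<in> J P"
  shows "\<bar>\<sigma> P t' - \<sigma> P t\<bar> \<le> (\<Sum>i\<in>UNIV. \<bar>m i\<bar>) * \<bar>t' - t\<bar>"
proof -
  define w where "w i = 1 / (q i t (\<sigma> P t) * q i t' (\<sigma> P t'))" for i
  define M where "M = (\<Sum>i\<in>UNIV. \<bar>m i\<bar>)"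
  have w: "w i > 0" for i unfolding w_def
    using cell_mult_pos[OF sigma_cell[OF assms(1)] sigma_cell[OF assms(2)]] by simp
  then have W: "sum w UNIV > 0" by (intro sum_pos) auto
  have M: "\<bar>m i\<bar> \<le> M" for i unfolding M_def by (rule member_le_sum) auto
  have "(\<sigma> P t' - \<sigma> P t) * sum w UNIV = (t' - t) * (\<Sum>i\<in>UNIV. m i * w i)"
    using critical_difference[OF sigma_cell[OF assms(1)] sigma_cell[OF assms(2)]
        sigma_F[OF assms(1)] sigma_F[OF assms(2)]] by (simp add: w_def)
  then have "\<bar>\<sigma> P t' - \<sigma> P t\<bar> * sum w UNIV = \<bar>t' - t\<bar> * \<bar>\<Sum>i\<in>UNIV. m i * w i\<bar>"
    using W by (metis abs_mult abs_of_pos)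
  also have "\<dots> \<le> \<bar>t' - t\<bar> * (\<Sum>i\<in>UNIV. \<bar>m i\<bar> * w i)"
    using sum_abs[of "\<lambda>i. m i * w i" UNIV] w by (intro mult_left_mono) (auto simp: abs_mult less_imp_le)
  also have "\<dots> \<le> \<bar>t' - t\<bar> * (\<Sum>i\<in>UNIV. M * w i)"
    using M w by (intro mult_left_mono sum_mono mult_right_mono) (auto simp: less_imp_le)
  also have "\<dots> = M * \<bar>t' - t\<bar> * sum w UNIV" by (simp add: sum_distrib_left[symmetric] mult_ac)
  finally show ?thesis using W by (simp add: M_def)
qed

lemma continuous_sigma: "continuous_on (J P) (\<sigma> P)"
proof (rule continuous_onI)
  fix t e :: real assume t: "t \<in> J P" "e > 0"
  define M where "M = (\<Sum>i\<in>UNIV. \<bar>m i\<bar>) + 1"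
  have M: "M > 0" by (auto simp: M_def intro!: add_nonneg_pos sum_nonneg)
  have "dist (\<sigma> P t') (\<sigma> P t) \<le> e" if "t' \<in> J P" "dist t' t < e / M" for t'
  proof -
    have "\<bar>\<sigma> P t' - \<sigma> P t\<bar> \<le> (\<Sum>i\<in>UNIV. \<bar>m i\<bar>) * \<bar>t' - t\<bar>" by (rule sigma_Lipschitz) (use t that in auto)
    also have "\<dots> \<le> M * \<bar>t' - t\<bar>" by (simp add: M_def algebra_simps)
    also have "\<dots> \<le> e" using that M by (simp add: dist_real_def field_simps)
    finally show ?thesis by (simp add: dist_real_def)
  qed
  then show "\<exists>d>0. \<forall>t'\<in>J P. dist t' t < d \<longrightarrow> dist (\<sigma> P t') (\<sigma> P t) \<le> e"
    using t M by (intro exI[of _ "e / M"]) auto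
qed

lemma isCont_sigma: "t \<in> J P \<Longrightarrow> isCont (\<sigma> P) t"
  using continuous_sigma open_J continuous_on_eq_continuous_at by blast

lemma sigma_has_derivative:
  assumes t: "t \<in> J P"
  shows "(\<sigma> P has_real_derivative slope P t) (at t)"
proof -
  define w where "w t' i = 1 / (q i t (\<sigma> P t) * q i t' (\<sigma> P t'))" for t' i
  have tend: "((\<lambda>t'. q i t' (\<sigma> P t')) \<longlongrightarrow> q i t (\<sigma> P t)) (at t)" for i
    unfolding q_def by (intro tendsto_intros isContD[OF isCont_sigma[OF t]])
  have nz: "q i t (\<sigma> P t) \<noteq> 0" for i by (rule cell_nonzero[OF sigma_cell[OF t]])
  have pos: "(\<Sum>i\<in>UNIV. 1 / (q i t (\<sigma> P t) * q i t (\<sigma> P t))) \<noteq> 0"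
    using sum_weights_pos[OF sigma_cell[OF t] sigma_cell[OF t]] by simp
  \<comment> \<open>As \<open>t'\<close> tends to \<open>t\<close>, the weights in the difference
    quotient turn into the weights 1 / q_i^2 of \<open>slope\<close>.\<close>
  have "((\<lambda>t'. (\<Sum>i\<in>UNIV. m i * w t' i) / (\<Sum>i\<in>UNIV. w t' i)) \<longlongrightarrow> slope P t) (at t)"
    unfolding slope_def w_def power2_eq_square
    by (rule tendsto_eq_intros tend refl nz pos | use nz pos in force)+
  moreover have "eventually (\<lambda>t'. t' \<in> J P) (at t)"
    using open_J t eventually_at_topological by blast
  then have "eventually (\<lambda>t'. (\<Sum>i\<in>UNIV. m i * w t' i) / (\<Sum>i\<in>UNIV. w t' i) = (\<sigma> P t' - \<sigma> P t) / (t' - t)) (at t)"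
    using eventually_neq_at_within[of t t UNIV]
  proof eventually_elim
    case (elim t')
    have "sum (w t') UNIV > 0" unfolding w_def
      by (rule sum_weights_pos[OF sigma_cell[OF t] sigma_cell]) (fact elim(1))
    moreover have "(\<sigma> P t' - \<sigma> P t) * sum (w t') UNIV = (t' - t) * (\<Sum>i\<in>UNIV. m i * w t' i)"
      using critical_difference[OF sigma_cell[OF t] sigma_cell[OF elim(1)]
          sigma_F[OF t] sigma_F[OF elim(1)]] by (simp add: w_def)
    ultimately show ?case using elim(2) by (simp add: field_simps)
  qed
  ultimately have "((\<lambda>t'. (\<sigma> P t' - \<sigma> P t) / (t' - t)) \<longlongrightarrow> slope P t) (at t)"
    by (rule Lim_transform_eventually)
  then show ?thesis by (simp add: has_field_derivative_iff)
qed

lemma continuous_slope: "continuous_on (J P) (slope P)"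
proof -
  have "(q i t (\<sigma> P t))\<^sup>2 \<noteq> 0" if "t \<in> J P" for i t
    using cell_nonzero[OF sigma_cell[OF that]] by simp
  moreover have "(\<Sum>i\<in>UNIV. 1 / (q i t (\<sigma> P t))\<^sup>2) \<noteq> 0" if "t \<in> J P" for t
    using sum_weights_pos[OF sigma_cell[OF that] sigma_cell[OF that]] by (simp add: power2_eq_square)
  moreover have "continuous_on (J P) (\<lambda>t. q i t (\<sigma> P t))" for i
    unfolding q_def by (intro continuous_intros continuous_sigma)
  ultimately show ?thesis
    unfolding slope_def by (intro continuous_intros) auto
qed

text \<open>By \<open>G_eq\<close>, \<open>G u\<close> vanishes at a curve point exactly when the
  mean of the \<open>u - m j\<close>, with the weights of \<open>slope\<close>, is zero.\<close>

lemma slope_eq_iff: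
  assumes t: "t \<in> J P"
  shows "slope P t = u \<longleftrightarrow> poly2 (G u) t (\<sigma> P t) = 0"
proof -
  have nz: "q i t (\<sigma> P t) \<noteq> 0" for i by (rule cell_nonzero[OF sigma_cell[OF t]])
  have W: "(\<Sum>i\<in>UNIV. 1 / (q i t (\<sigma> P t))\<^sup>2) > 0"
    using sum_weights_pos[OF sigma_cell[OF t] sigma_cell[OF t]] by (simp add: power2_eq_square)
  have "poly2 (G u) t (\<sigma> P t) = 0 \<longleftrightarrow> (\<Sum>j\<in>UNIV. (u - m j) / (q j t (\<sigma> P t))\<^sup>2) = 0"
    using G_eq[of t "\<sigma> P t" u, OF nz sigma_F[OF t]] nz by simp
  also have "\<dots> \<longleftrightarrow> u * (\<Sum>i\<in>UNIV. 1 / (q i t (\<sigma> P t))\<^sup>2) = (\<Sum>i\<in>UNIV. m i / (q i t (\<sigma> P t))\<^sup>2)"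
    by (simp add: diff_divide_distrib sum_subtractf sum_distrib_left)
  also have "\<dots> \<longleftrightarrow> slope P t = u" using W by (auto simp: slope_def field_simps)
  finally show ?thesis ..
qed

end

end

section \<open>Points of given slope\<close>

text \<open>If the degree exceeded \<open>N\<close>, the quotient of (1 + t)^N by \<open>p\<close>
  would tend to 0 at +infinity, against the bound. The estimate is only eventual, so that all
  crossings can be left behind.\<close>

lemma degree_le_of_growth:
  fixes p :: "real poly"
  assumes "eventually (\<lambda>t. \<bar>poly p t\<bar> \<le> K * (1 + \<bar>t\<bar>) ^ N) at_top"
  shows "degree p \<le> N"
proof (rule ccontr)
  assume "\<not> degree p \<le> N"
  then have deg: "degree p > degree ([:1, 1 :: real:] ^ N)" by (simp add: degree_power_eq)
  then have "p \<noteq> 0" by auto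
  have "((\<lambda>t. poly ([:1, 1:] ^ N) t / poly p t) \<longlongrightarrow> 0) at_top"
    using poly_divide_tendsto_0_at_infinity[OF deg] at_top_le_at_infinity tendsto_mono by blast
  then have "((\<lambda>t. \<bar>poly ([:1, 1:] ^ N) t / poly p t\<bar>) \<longlongrightarrow> 0) at_top" by (rule tendsto_rabs_zero)
  then have "eventually (\<lambda>t. \<bar>poly ([:1, 1:] ^ N) t / poly p t\<bar> < 1 / (\<bar>K\<bar> + 1)) at_top"
    by (rule order_tendstoD(2)) simp
  moreover have "eventually (\<lambda>t. poly p t \<noteq> 0) at_top"
    using poly_eventually_not_zero[OF \<open>p \<noteq> 0\<close>] at_top_le_at_infinity filter_leD by blast
  ultimately have "eventually (\<lambda>t::real. False) at_top"
    using assms eventually_gt_at_top[of 0]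
  proof eventually_elim
    case (elim t)
    define z where "z = (1 + t) ^ N"
    have z: "z > 0" using elim(4) by (simp add: z_def)
    have "\<bar>poly ([:1, 1:] ^ N) t\<bar> = z" using elim(4) by (simp add: poly_power z_def)
    then have "z / \<bar>poly p t\<bar> < 1 / (\<bar>K\<bar> + 1)" using elim(1) by (simp add: abs_divide)
    then have "z * (\<bar>K\<bar> + 1) < \<bar>poly p t\<bar>" using elim(2) by (simp add: field_simps)
    also have "\<dots> \<le> K * z" using elim(3,4) by (simp add: z_def)
    also have "\<dots> \<le> z * \<bar>K\<bar>" using z by (simp add: mult.commute)
    finally show False using z by (simp add: algebra_simps)
  qed
  then show False by simp
qed

text \<open>Cancelling the exact power of t - a leaves a factor that is nonzero at \<open>a\<close>;
  faster decay of \<open>p\<close> would force this factor to vanish there. The bound is on a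
  punctured neighbourhood, since in the application lines may cross over \<open>a\<close>.\<close>

lemma order_ge_of_vanishing:
  fixes p :: "real poly"
  assumes "p \<noteq> 0" and ev: "eventually (\<lambda>t. \<bar>poly p t\<bar> \<le> K * \<bar>t - a\<bar> ^ N) (at a)"
  shows "N \<le> order a p"
proof (rule ccontr)
  assume "\<not> N \<le> order a p"
  then obtain e where e: "N = order a p + e" "e > 0" using less_imp_add_positive[of "order a p" N] by auto
  obtain g where g: "p = [:- a, 1:] ^ order a p * g" "\<not> [:- a, 1:] dvd g"
    using order_decomp[OF \<open>p \<noteq> 0\<close>] by blast
  have pt: "poly p t = (t - a) ^ order a p * poly g t" for t
    by (subst g(1)) (simp add: poly_power algebra_simps)
  have "eventually (\<lambda>t. \<bar>poly g t\<bar> \<le> K * \<bar>t - a\<bar> ^ e) (at a)"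
    using ev eventually_neq_at_within[of a a UNIV]
  proof eventually_elim
    case (elim t)
    then have "\<bar>t - a\<bar> ^ order a p * \<bar>poly g t\<bar> \<le> \<bar>t - a\<bar> ^ order a p * (K * \<bar>t - a\<bar> ^ e)"
      unfolding pt e(1) by (simp add: abs_mult power_abs power_add mult_ac)
    then show ?case using elim(2) by simp
  qed
  moreover have "((\<lambda>t. K * \<bar>t - a\<bar> ^ e) \<longlongrightarrow> K * \<bar>a - a\<bar> ^ e) (at a)" by (intro tendsto_intros)
  moreover have "((\<lambda>t. \<bar>poly g t\<bar>) \<longlongrightarrow> \<bar>poly g a\<bar>) (at a)" by (intro tendsto_intros)
  ultimately have "\<bar>poly g a\<bar> \<le> K * \<bar>a - a\<bar> ^ e"
    using tendsto_le[OF at_neq_bot] by blast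
  then have "poly g a = 0" using e by (simp add: zero_power)
  then show False using g(2) by (simp add: poly_eq_0_iff_dvd)
qed

lemma poly2_differentiable:
  assumes "f differentiable (at t)"
  shows "(\<lambda>x. poly2 p x (f x)) differentiable (at t)"
proof -
  have "poly r differentiable (at t)" for r :: "real poly"
    unfolding real_differentiable_def by (rule exI, rule poly_DERIV)
  then have "(\<lambda>x. \<Sum>l<Suc (degree p). poly (coeff p l) x * f x ^ l) differentiable (at t)"
    by (intro differentiable_sum ballI differentiable_mult differentiable_power assms finite_lessThan)
  then show ?thesis using poly2_altdef[of p "Suc (degree p)"] by simp
qed

lemma differentiable_zero_bound:
  fixes g :: "real \<Rightarrow> real"
  assumes "g differentiable (at a)" "g a = 0"
  shows "\<exists>C. eventually (\<lambda>t. \<bar>g t\<bar> \<le> C * \<bar>t - a\<bar>) (at a)"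
proof -
  obtain g' where "(g has_real_derivative g') (at a)"
    using assms real_differentiable_def by blast
  then have "((\<lambda>t. g t / (t - a)) \<longlongrightarrow> g') (at a)"
    using assms(2) by (simp add: has_field_derivative_iff)
  then have "((\<lambda>t. \<bar>g t / (t - a)\<bar>) \<longlongrightarrow> \<bar>g'\<bar>) (at a)" by (rule tendsto_rabs)
  then have "eventually (\<lambda>t. \<bar>g t / (t - a)\<bar> < \<bar>g'\<bar> + 1) (at a)"
    by (rule order_tendstoD) simp
  then have "eventually (\<lambda>t. \<bar>g t\<bar> \<le> (\<bar>g'\<bar> + 1) * \<bar>t - a\<bar>) (at a)"
    using eventually_neq_at_within[of a a UNIV]
    by eventually_elim (simp add: abs_divide pos_divide_less_eq less_imp_le)
  then show ?thesis by (rule exI)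
qed

lemma eventually_not_in_finite:
  fixes a :: "'a::t1_space"
  assumes "finite X"
  shows "eventually (\<lambda>t. t \<notin> X) (at a)"
proof -
  have "closed (X - {a})" using assms by (simp add: finite_imp_closed)
  then have "open (- (X - {a}))" by (rule open_Compl)
  then show ?thesis unfolding eventually_at_topological by (intro exI[of _ "- (X - {a})"]) auto
qed

context line_family
begin

text \<open>Up to a constant factor, \<open>D\<close> is the resultant of \<open>F\<close> and
  \<open>G u\<close> with respect to \<open>s\<close>. The product formula is claimed only where the
  lines have distinct heights, because \<open>ex_poly_prod_over_roots\<close> asks for n-1 distinct
  roots.\<close>

lemma ex_discriminant:
  obtains D where "\<And>t. inj (\<lambda>i. m i * t + k i) \<Longrightarrow> poly D t = (\<Prod>s | poly2 F t s = 0. poly2 (G u) t s)"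
proof -
  have "0 < CARD('n) - 1" "real CARD('n) \<noteq> 0" using card_ge by auto
  from ex_poly_prod_over_roots[OF lead_coeff_F this(2) degree_F this(1), of "G u"]
  obtain D where D: "\<And>t S. card S = CARD('n) - 1 \<Longrightarrow> (\<And>s. s \<in> S \<Longrightarrow> poly2 F t s = 0) \<Longrightarrow>
      poly D t = (\<Prod>s\<in>S. poly2 (G u) t s)" by blast
  have "poly D t = (\<Prod>s | poly2 F t s = 0. poly2 (G u) t s)" if inj: "inj (\<lambda>i. m i * t + k i)" for t
  proof -
    obtain S where S: "S = {s. poly2 F t s = 0}" "card S = CARD('n) - 1"
      using roots_F[OF inj] by blast
    show ?thesis unfolding S(1)[symmetric] by (rule D[OF S(2)]) (simp add: S(1))
  qed
  then show thesis by (rule that)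
qed

text \<open>Off the crossings \<open>D\<close> is a product of n-1 factors, one for each root. All
  roots lie between lines, where \<open>G_bound\<close> gives each factor growth of order
  n-2.\<close>

lemma degree_discriminant:
  assumes D: "\<And>t. inj (\<lambda>i. m i * t + k i) \<Longrightarrow> poly D t = (\<Prod>s | poly2 F t s = 0. poly2 (G u) t s)"
  shows "degree D \<le> (CARD('n) - 1) * (CARD('n) - 2)"
proof -
  obtain K where K: "K \<ge> 1"
    "\<And>t s. \<exists>i. q i t s > 0 \<Longrightarrow> \<exists>i. q i t s < 0 \<Longrightarrow> \<bar>poly2 (G u) t s\<bar> \<le> K * (1 + \<bar>t\<bar>) ^ (CARD('n) - 2)"
    using G_bound by blast
  have bound: "\<bar>poly D t\<bar> \<le> K ^ (CARD('n) - 1) * (1 + \<bar>t\<bar>) ^ ((CARD('n) - 1) * (CARD('n) - 2))"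
    if inj: "inj (\<lambda>i. m i * t + k i)" for t
  proof -
    obtain S where S: "S = {s. poly2 F t s = 0}" "finite S" "card S = CARD('n) - 1"
      "\<And>s. s \<in> S \<Longrightarrow> \<exists>i. q i t s > 0" "\<And>s. s \<in> S \<Longrightarrow> \<exists>i. q i t s < 0"
      using roots_F[OF inj] by blast
    have "\<bar>poly D t\<bar> = (\<Prod>s\<in>S. \<bar>poly2 (G u) t s\<bar>)" unfolding D[OF inj] S(1) abs_prod ..
    also have "\<dots> \<le> (\<Prod>s\<in>S. K * (1 + \<bar>t\<bar>) ^ (CARD('n) - 2))"
      by (rule prod_mono) (use K(2) S(4,5) in auto)
    also have "\<dots> = K ^ (CARD('n) - 1) * (1 + \<bar>t\<bar>) ^ ((CARD('n) - 1) * (CARD('n) - 2))"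
      by (simp add: S(3) power_mult_distrib power_mult[symmetric] mult.commute)
    finally show ?thesis .
  qed
  \<comment> \<open>True past the last crossing; 0 is inserted to keep \<open>Max\<close> off the
    empty set.\<close>
  have "eventually (\<lambda>t. inj (\<lambda>i. m i * t + k i)) at_top"
    using eventually_gt_at_top[of "Max (insert 0 {t. \<not> inj (\<lambda>i. m i * t + k i)})"]
  proof eventually_elim
    case (elim t)
    then have "t \<notin> insert 0 {t. \<not> inj (\<lambda>i. m i * t + k i)}"
      using Max_ge[OF finite.insertI[OF finite_crossings], of t 0] by (meson not_less)
    then show ?case by simp
  qed
  then have "eventually (\<lambda>t. \<bar>poly D t\<bar> \<le> K ^ (CARD('n) - 1) * (1 + \<bar>t\<bar>) ^ ((CARD('n) - 1) * (CARD('n) - 2))) at_top"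
    by (rule eventually_mono) (rule bound)
  then show ?thesis by (rule degree_le_of_growth)
qed

text \<open>Near \<open>a\<close> every cell in \<open>PP\<close> contributes its own factor of size
  O(|t - a|) to \<open>D\<close>, distinct cells having distinct roots, while the remaining factors
  stay bounded. So \<open>D\<close> vanishes at \<open>a\<close> at least to the order
  \<open>card PP\<close>.\<close>

lemma order_discriminant:
  assumes D: "\<And>t. inj (\<lambda>i. m i * t + k i) \<Longrightarrow> poly D t = (\<Prod>s | poly2 F t s = 0. poly2 (G u) t s)"
    and "D \<noteq> 0"
    and PP: "\<And>P. P \<in> PP \<Longrightarrow> P \<noteq> {} \<and> P \<noteq> UNIV \<and> a \<in> J P \<and> slope P a = u"
  shows "card PP \<le> order a D"
proof -
  have "\<exists>C. eventually (\<lambda>t. \<bar>poly2 (G u) t (\<sigma> P t)\<bar> \<le> C * \<bar>t - a\<bar>) (at a)" if "P \<in> PP" for P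
  proof (rule differentiable_zero_bound)
    have "\<sigma> P differentiable (at a)"
      using sigma_has_derivative[of P a] PP[OF that] unfolding real_differentiable_def by blast
    then show "(\<lambda>t. poly2 (G u) t (\<sigma> P t)) differentiable (at a)" by (rule poly2_differentiable)
    show "poly2 (G u) a (\<sigma> P a) = 0" using slope_eq_iff[of P a u] PP[OF that] by simp
  qed
  then obtain C where C: "\<And>P. P \<in> PP \<Longrightarrow> eventually (\<lambda>t. \<bar>poly2 (G u) t (\<sigma> P t)\<bar> \<le> C P * \<bar>t - a\<bar>) (at a)"
    by metis
  obtain K where K: "K \<ge> 1"
    "\<And>t s. \<exists>i. q i t s > 0 \<Longrightarrow> \<exists>i. q i t s < 0 \<Longrightarrow> \<bar>poly2 (G u) t s\<bar> \<le> K * (1 + \<bar>t\<bar>) ^ (CARD('n) - 2)"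
    using G_bound by blast
  \<comment> \<open>Bounds \<open>G u\<close> at all roots over |t - a| < 1, where 1 + |t| is at
    most 2 + |a|.\<close>
  define K1 where "K1 = K * (2 + \<bar>a\<bar>) ^ (CARD('n) - 2)"
  have "1 * 1 \<le> K1" unfolding K1_def by (rule mult_mono) (use K in auto)
  then have K1: "1 \<le> K1" by simp
  have "eventually (\<lambda>t. t \<notin> {t. \<not> inj (\<lambda>i. m i * t + k i)}) (at a)"
    by (rule eventually_not_in_finite[OF finite_crossings])
  moreover have "eventually (\<lambda>t. \<forall>P\<in>PP. \<bar>poly2 (G u) t (\<sigma> P t)\<bar> \<le> C P * \<bar>t - a\<bar>) (at a)"
    using C by (simp add: eventually_ball_finite)
  moreover have "eventually (\<lambda>t. \<forall>P\<in>PP. t \<in> J P) (at a)"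
    using PP by (intro eventually_ball_finite) (auto intro!: eventually_at_in_open' open_J)
  moreover have "eventually (\<lambda>t. \<bar>t - a\<bar> < 1) (at a)"
    unfolding eventually_at by (rule exI[of _ 1]) (auto simp: dist_real_def)
  ultimately have "eventually (\<lambda>t. \<bar>poly D t\<bar> \<le> (prod C PP * K1 ^ (CARD('n) - 1)) * \<bar>t - a\<bar> ^ card PP) (at a)"
  proof eventually_elim
    case (elim t)
    then have inj: "inj (\<lambda>i. m i * t + k i)" by simp
    obtain S where S: "S = {s. poly2 F t s = 0}" "finite S" "card S = CARD('n) - 1"
      "\<And>s. s \<in> S \<Longrightarrow> \<exists>i. q i t s > 0" "\<And>s. s \<in> S \<Longrightarrow> \<exists>i. q i t s < 0"
      using roots_F[OF inj] by blast
    define A where "A = (\<lambda>P. \<sigma> P t) ` PP"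
    have inj_A: "inj_on (\<lambda>P. \<sigma> P t) PP"
    proof (rule inj_onI)
      fix P P' assume *: "P \<in> PP" "P' \<in> PP" "\<sigma> P t = \<sigma> P' t"
      then have "cell P t (\<sigma> P t)" "cell P' t (\<sigma> P' t)"
        using PP elim(3) sigma_cell by blast+
      then show "P = P'" using *(3) cell_inj by simp
    qed
    have AS: "A \<subseteq> S" using PP elim(3) sigma_F by (auto simp: A_def S(1))
    have "\<bar>poly2 (G u) t s\<bar> \<le> K1" if "s \<in> S" for s
    proof -
      have "\<bar>poly2 (G u) t s\<bar> \<le> K * (1 + \<bar>t\<bar>) ^ (CARD('n) - 2)" using K(2) S(4,5) that by blast
      also have "\<dots> \<le> K1" unfolding K1_def
        by (intro mult_left_mono power_mono) (use elim(4) K in auto)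
      finally show ?thesis .
    qed
    then have "(\<Prod>s\<in>S - A. \<bar>poly2 (G u) t s\<bar>) \<le> K1 ^ card (S - A)"
      by (intro prod_le_power) (use K1 in auto)
    also have "\<dots> \<le> K1 ^ (CARD('n) - 1)"
      by (intro power_increasing K1) (use card_mono[OF S(2), of "S - A"] S(3) in auto)
    finally have 1: "(\<Prod>s\<in>S - A. \<bar>poly2 (G u) t s\<bar>) \<le> K1 ^ (CARD('n) - 1)" .
    have "(\<Prod>s\<in>A. \<bar>poly2 (G u) t s\<bar>) = (\<Prod>P\<in>PP. \<bar>poly2 (G u) t (\<sigma> P t)\<bar>)"
      unfolding A_def by (simp add: prod.reindex[OF inj_A])
    also have "\<dots> \<le> (\<Prod>P\<in>PP. C P * \<bar>t - a\<bar>)"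
      by (rule prod_mono) (use elim(2) in auto)
    also have "\<dots> = prod C PP * \<bar>t - a\<bar> ^ card PP" by (simp add: prod.distrib)
    finally have 2: "(\<Prod>s\<in>A. \<bar>poly2 (G u) t s\<bar>) \<le> prod C PP * \<bar>t - a\<bar> ^ card PP" .
    have "\<bar>poly D t\<bar> = (\<Prod>s\<in>A. \<bar>poly2 (G u) t s\<bar>) * (\<Prod>s\<in>S - A. \<bar>poly2 (G u) t s\<bar>)"
      unfolding D[OF inj] S(1)[symmetric] abs_prod
      using prod.subset_diff[OF AS S(2)] by (simp add: mult.commute)
    \<comment> \<open>The signs of the \<open>C P\<close> are unknown; the nonnegativity that
      \<open>mult_mono\<close> asks for is read off from estimate \<open>2\<close>.\<close>
    also have "\<dots> \<le> prod C PP * \<bar>t - a\<bar> ^ card PP * K1 ^ (CARD('n) - 1)"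
      by (rule mult_mono[OF 2 1 order_trans[OF _ 2]]) (simp_all add: prod_nonneg)
    finally show ?case by (simp add: mult_ac)
  qed
  then show ?thesis by (rule order_ge_of_vanishing[OF \<open>D \<noteq> 0\<close>])
qed

text \<open>A point is recorded as a pair of cell and abscissa. With \<open>W\<close> grouped by
  abscissa, each group is at most the order of a zero of \<open>D\<close>, and the orders add up to
  at most the degree.\<close>

lemma card_slope_le:
  obtains E where "finite E"
    "\<forall>u W. u \<notin> E \<longrightarrow> finite W \<longrightarrow>
       (\<forall>P t. (P, t) \<in> W \<longrightarrow> P \<noteq> {} \<and> P \<noteq> UNIV \<and> t \<in> J P \<and> slope P t = u) \<longrightarrow>
       card W \<le> (CARD('n) - 1) * (CARD('n) - 2)"
proof -
  obtain t0 where "t0 \<notin> {t. \<not> inj (\<lambda>i. m i * t + k i)}"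
    using ex_new_if_finite[OF infinite_UNIV_char_0 finite_crossings] by blast
  then have t0: "inj (\<lambda>i. m i * t0 + k i)" by simp
  obtain S where S: "S = {s. poly2 F t0 s = 0}" "finite S"
    by (rule roots_F[OF t0]) (rule that)
  \<comment> \<open>The slopes of the curve over one abscissa \<open>t0\<close> without crossings.
    For any other \<open>u\<close> no factor of \<open>D\<close> vanishes at \<open>t0\<close>, so
    \<open>D\<close> is not the zero polynomial.\<close>
  define E where "E = (\<lambda>s. (\<Sum>i\<in>UNIV. m i / (q i t0 s)\<^sup>2) / (\<Sum>i\<in>UNIV. 1 / (q i t0 s)\<^sup>2)) ` S"
  have G0: "poly2 (G u) t0 s \<noteq> 0" if u: "u \<notin> E" and s: "s \<in> S" for u s
  proof -
    have nz: "q i t0 s \<noteq> 0" for i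
    proof
      assume i: "q i t0 s = 0"
      have j: "q j t0 s \<noteq> 0" if "j \<noteq> i" for j
      proof
        assume "q j t0 s = 0"
        then have "m j * t0 + k j = m i * t0 + k i" using i by (simp add: q_def)
        then show False using t0 that by (auto simp: inj_def)
      qed
      \<comment> \<open>If the curve point lay on line \<open>i\<close>, only the summand of
        \<open>F\<close> omitting \<open>q i\<close> would survive, and it is nonzero because no
        other line passes through the point.\<close>
      have "(\<Sum>i'\<in>UNIV. \<Prod>j\<in>UNIV - {i'}. q j t0 s) = (\<Sum>i'\<in>{i}. \<Prod>j\<in>UNIV - {i'}. q j t0 s)"
        by (rule sum.mono_neutral_right) (use i in auto)
      then have "(\<Prod>j\<in>UNIV - {i}. q j t0 s) = 0" using s by (simp add: S(1) poly2_F)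
      then show False using j by auto
    qed
    define W where "W = (\<Sum>i\<in>UNIV. 1 / (q i t0 s)\<^sup>2)"
    have W: "W > 0" unfolding W_def using nz by (intro sum_pos) auto
    have "u \<noteq> (\<Sum>i\<in>UNIV. m i / (q i t0 s)\<^sup>2) / W" using u s by (auto simp: E_def W_def)
    moreover have "(\<Sum>i\<in>UNIV. (u - m i) / (q i t0 s)\<^sup>2) = u * W - (\<Sum>i\<in>UNIV. m i / (q i t0 s)\<^sup>2)"
      by (simp add: W_def diff_divide_distrib sum_subtractf sum_distrib_left)
    ultimately have "(\<Sum>i\<in>UNIV. (u - m i) / (q i t0 s)\<^sup>2) \<noteq> 0"
      using W by (simp add: eq_divide_eq)
    moreover have "poly2 F t0 s = 0" using s S(1) by simp
    ultimately show ?thesis using G_eq[of t0 s u, OF nz] nz by simp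
  qed
  show thesis
  proof (rule that[of E], goal_cases)
    case 1
    show "finite E" unfolding E_def using S(2) by simp
  next
    case 2
    show ?case
    proof (intro allI impI)
      fix u and W :: "('n set \<times> real) set"
      assume u: "u \<notin> E" and fin: "finite W"
        and W: "\<forall>P t. (P, t) \<in> W \<longrightarrow> P \<noteq> {} \<and> P \<noteq> UNIV \<and> t \<in> J P \<and> slope P t = u"
      obtain D where D: "\<And>t. inj (\<lambda>i. m i * t + k i) \<Longrightarrow> poly D t = (\<Prod>s | poly2 F t s = 0. poly2 (G u) t s)"
        using ex_discriminant by blast
      have "poly D t0 \<noteq> 0"
        unfolding D[OF t0] S(1)[symmetric] using G0[OF u] S(2) by (simp add: prod_zero_iff)
      then have "D \<noteq> 0" by auto
      have "card W = (\<Sum>t\<in>snd ` W. card {w \<in> W. snd w = t})"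
        using sum.image_gen[OF fin, of "\<lambda>_. 1 :: nat" snd] by simp
      also have "\<dots> \<le> (\<Sum>t\<in>snd ` W. order t D)"
      proof (rule sum_mono)
        fix t
        have "card {w \<in> W. snd w = t} = card (fst ` {w \<in> W. snd w = t})"
          by (rule card_image[symmetric]) (auto intro!: inj_onI prod_eqI)
        also have "\<dots> \<le> order t D"
          by (rule order_discriminant[OF D \<open>D \<noteq> 0\<close>]) (use W in auto)
        finally show "card {w \<in> W. snd w = t} \<le> order t D" .
      qed
      also have "\<dots> = (\<Sum>t\<in>snd ` W. count (proots D) t)" using \<open>D \<noteq> 0\<close> by simp
      also have "\<dots> \<le> (\<Sum>t\<in>snd ` W \<union> set_mset (proots D). count (proots D) t)"
        by (rule sum_mono2) (use fin in auto)
      also have "\<dots> = size (proots D)"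
        unfolding size_multiset_overloaded_eq
        by (rule sum.mono_neutral_right) (use fin in \<open>auto simp: not_in_iff\<close>)
      also have "\<dots> \<le> degree D" by (rule size_proots_le)
      also have "\<dots> \<le> (CARD('n) - 1) * (CARD('n) - 2)" by (rule degree_discriminant[OF D])
      finally show "card W \<le> (CARD('n) - 1) * (CARD('n) - 2)" .
    qed
  qed
qed

end

section \<open>Total variation of the slope angle\<close>

text \<open>A bound on every simultaneous choice passes to the suprema one index at a time;
  \<open>r\<close> holds the terms chosen already. If some \<open>X i\<close> were empty there would
  be no choice at all, and the bound would say nothing.\<close>

lemma sum_SUP_le:
  fixes f :: "'a \<Rightarrow> 'b \<Rightarrow> ennreal"
  assumes "finite A" and "\<And>i. i \<in> A \<Longrightarrow> X i \<noteq> {}"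
    and "\<And>c. (\<And>i. i \<in> A \<Longrightarrow> c i \<in> X i) \<Longrightarrow> r + (\<Sum>i\<in>A. f i (c i)) \<le> B"
  shows "r + (\<Sum>i\<in>A. SUP x\<in>X i. f i x) \<le> B"
  using assms
proof (induction A arbitrary: r rule: finite_induct)
  case empty
  then show ?case by simp
next
  case (insert a A)
  have "r + f a x + (\<Sum>i\<in>A. SUP x\<in>X i. f i x) \<le> B" if x: "x \<in> X a" for x
  proof (rule insert.IH)
    show "X i \<noteq> {}" if "i \<in> A" for i using insert.prems(1) that by simp
    fix c assume c: "\<And>i. i \<in> A \<Longrightarrow> c i \<in> X i"
    have eq: "(\<Sum>i\<in>A. f i ((c(a := x)) i)) = (\<Sum>i\<in>A. f i (c i))"
      by (rule sum.cong) (use insert.hyps in auto)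
    have "(\<Sum>i\<in>insert a A. f i ((c(a := x)) i)) = f a ((c(a := x)) a) + (\<Sum>i\<in>A. f i ((c(a := x)) i))"
      by (rule sum.insert) (fact insert.hyps)+
    also have "\<dots> = f a x + (\<Sum>i\<in>A. f i (c i))" unfolding eq by simp
    finally have split: "(\<Sum>i\<in>insert a A. f i ((c(a := x)) i)) = f a x + (\<Sum>i\<in>A. f i (c i))" .
    have "r + (\<Sum>i\<in>insert a A. f i ((c(a := x)) i)) \<le> B"
      by (rule insert.prems(2)) (use c x in auto)
    then show "r + f a x + (\<Sum>i\<in>A. f i (c i)) \<le> B" unfolding split by (simp add: add.assoc)
  qed
  then have "(SUP x\<in>X a. (r + (\<Sum>i\<in>A. SUP x\<in>X i. f i x)) + f a x) \<le> B"
    by (intro SUP_least) (simp add: add_ac)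
  moreover have "X a \<noteq> {}" using insert.prems(1) by simp
  ultimately have "(r + (\<Sum>i\<in>A. SUP x\<in>X i. f i x)) + (SUP x\<in>X a. f a x) \<le> B"
    by (simp add: ennreal_SUP_add_right)
  then show ?case using insert.hyps by (simp add: add_ac)
qed

text \<open>The cells share the zeros of \<open>D\<close>, so their variations are bounded only
  together, for one partition chosen in each; this turns such a bound into one on the sum of the arc
  lengths.\<close>

lemma arc_length_real_le_sum:
  fixes I :: "'a \<Rightarrow> real set"
  assumes "finite A"
    and "\<And>M s. (\<And>i. i \<in> A \<Longrightarrow> mono_on {..M i} (s i) \<and> s i ` {..M i} \<subseteq> I i) \<Longrightarrow>
      (\<Sum>i\<in>A. \<Sum>k<M i. \<bar>g i (s i k) - g i (s i (Suc k))\<bar>) \<le> B"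
    and ne: "\<And>i. i \<in> A \<Longrightarrow> I i \<noteq> {}"
  shows "(\<Sum>i\<in>A. arc_length (g i) (I i)) \<le> ennreal B"
proof -
  define X where "X i = {(m :: nat, s :: nat \<Rightarrow> real). mono_on {..m} s \<and> s ` {..m} \<subseteq> I i}" for i
  define f where "f i = (\<lambda>(m :: nat, s). \<Sum>k<m. ennreal (dist (g i (s k)) (g i (s (Suc k)))))" for i
  have "X i \<noteq> {}" if i: "i \<in> A" for i
  proof -
    obtain x where "x \<in> I i" using ne[OF i] by blast
    then have "(0, \<lambda>_. x) \<in> X i" by (simp add: X_def mono_on_def)
    then show ?thesis by blast
  qed
  moreover have "0 + (\<Sum>i\<in>A. f i (c i)) \<le> ennreal B" if c: "\<And>i. i \<in> A \<Longrightarrow> c i \<in> X i" for c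
  proof -
    have "f i (c i) = ennreal (\<Sum>k<fst (c i). \<bar>g i (snd (c i) k) - g i (snd (c i) (Suc k))\<bar>)" for i
      by (simp add: f_def split_beta dist_real_def sum_ennreal)
    then have "(\<Sum>i\<in>A. f i (c i))
        = ennreal (\<Sum>i\<in>A. \<Sum>k<fst (c i). \<bar>g i (snd (c i) k) - g i (snd (c i) (Suc k))\<bar>)"
      by (simp add: sum_nonneg)
    also have "\<dots> \<le> ennreal B"
    proof (intro ennreal_leI assms(2))
      fix i assume "i \<in> A"
      from c[OF this] show "mono_on {..fst (c i)} (snd (c i)) \<and> snd (c i) ` {..fst (c i)} \<subseteq> I i"
        by (simp add: X_def split_beta)
    qed
    finally show ?thesis by simp
  qed
  ultimately have "0 + (\<Sum>i\<in>A. SUP x\<in>X i. f i x) \<le> ennreal B"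
    by (rule sum_SUP_le[OF assms(1)])
  then show ?thesis by (simp only: add_0 arc_length_def X_def f_def)
qed

context line_family
begin

text \<open>The Banach indicatrix argument on fixed finite partitions: the sum of the increments is
  the integral over phi of the number of steps whose range of angles contains phi, and each such
  step yields a point of slope tan phi.\<close>

lemma total_variation_slope:
  fixes M :: "'n set \<Rightarrow> nat" and x :: "'n set \<Rightarrow> nat \<Rightarrow> real"
  assumes PP: "\<And>P. P \<in> PP \<Longrightarrow> P \<noteq> {} \<and> P \<noteq> UNIV"
    and x: "\<And>P. P \<in> PP \<Longrightarrow> mono_on {..M P} (x P) \<and> x P ` {..M P} \<subseteq> J P"
  shows "(\<Sum>P\<in>PP. \<Sum>k<M P. \<bar>arctan (slope P (x P k)) - arctan (slope P (x P (Suc k)))\<bar>)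
    \<le> pi * real ((CARD('n) - 1) * (CARD('n) - 2))"
proof -
  define L where "L = (CARD('n) - 1) * (CARD('n) - 2)"
  define \<theta> where "\<theta> P t = arctan (slope P t)" for P t
  define \<Lambda> where "\<Lambda> = Sigma PP (\<lambda>P. {..<M P})"
  define lo hi where "lo = (\<lambda>(P, k). min (\<theta> P (x P k)) (\<theta> P (x P (Suc k))))"
    and "hi = (\<lambda>(P, k). max (\<theta> P (x P k)) (\<theta> P (x P (Suc k))))"
  have fin: "finite \<Lambda>" by (simp add: \<Lambda>_def)
  obtain E where E: "finite E"
    "\<forall>u W. u \<notin> E \<longrightarrow> finite W \<longrightarrow>
       (\<forall>P t. (P, t) \<in> W \<longrightarrow> P \<noteq> {} \<and> P \<noteq> UNIV \<and> t \<in> J P \<and> slope P t = u) \<longrightarrow>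
       card W \<le> L"
    by (rule card_slope_le[folded L_def]) (rule that)
  \<comment> \<open>An angle strictly between the end values is attained strictly inside the step.
    Steps of one partition share at most end points, so different steps yield different
    points.\<close>
  have hit: "\<exists>t. x P k < t \<and> t < x P (Suc k) \<and> t \<in> J P \<and> \<theta> P t = \<phi>"
    if Pk: "(P, k) \<in> \<Lambda>" and \<phi>: "lo (P, k) < \<phi>" "\<phi> < hi (P, k)" for P k \<phi>
  proof -
    have P: "P \<in> PP" "k < M P" using Pk by (auto simp: \<Lambda>_def)
    have xJ: "x P k \<in> J P" "x P (Suc k) \<in> J P" using x[OF P(1)] P(2) by auto
    have le: "x P k \<le> x P (Suc k)" using x[OF P(1)] P(2) by (auto simp: mono_on_def)
    have sub: "{x P k..x P (Suc k)} \<subseteq> J P"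
      using connected_contains_Icc[OF connected_J xJ] .
    have "continuous_on {x P k..x P (Suc k)} (\<theta> P)"
      unfolding \<theta>_def using continuous_on_subset[OF continuous_slope sub] PP[OF P(1)]
      by (intro continuous_intros) auto
    then have "connected (\<theta> P ` {x P k..x P (Suc k)})"
      by (rule connected_continuous_image) simp
    moreover have "lo (P, k) \<in> \<theta> P ` {x P k..x P (Suc k)}" "hi (P, k) \<in> \<theta> P ` {x P k..x P (Suc k)}"
      using le by (auto simp: lo_def hi_def min_def max_def)
    ultimately have "{lo (P, k)..hi (P, k)} \<subseteq> \<theta> P ` {x P k..x P (Suc k)}"
      using connected_contains_Icc by blast
    moreover have "\<phi> \<in> {lo (P, k)..hi (P, k)}" using \<phi> by simp
    ultimately have "\<phi> \<in> \<theta> P ` {x P k..x P (Suc k)}" by blast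
    then obtain t where t: "x P k \<le> t" "t \<le> x P (Suc k)" "\<theta> P t = \<phi>" by auto
    moreover have "t \<noteq> x P k" "t \<noteq> x P (Suc k)" using t(3) \<phi> by (auto simp: lo_def hi_def)
    ultimately show ?thesis using sub by (intro exI[of _ t]) auto
  qed
  have count: "(\<Sum>z\<in>\<Lambda>. indicator {lo z<..<hi z} \<phi> :: ennreal)
      \<le> ennreal (real L) * indicator {-(pi/2)..pi/2} \<phi>" if \<phi>: "\<phi> \<notin> arctan ` E" for \<phi>
  proof -
    define \<Lambda>' where "\<Lambda>' = {z\<in>\<Lambda>. lo z < \<phi> \<and> \<phi> < hi z}"
    have fin': "finite \<Lambda>'" using fin by (simp add: \<Lambda>'_def)
    have "(\<Sum>z\<in>\<Lambda>. indicator {lo z<..<hi z} \<phi> :: ennreal) = (\<Sum>z\<in>\<Lambda>'. 1)"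
      unfolding \<Lambda>'_def by (subst sum.inter_filter[OF fin]) (auto intro!: sum.cong simp: indicator_def)
    then have sum: "(\<Sum>z\<in>\<Lambda>. indicator {lo z<..<hi z} \<phi> :: ennreal) = of_nat (card \<Lambda>')" by simp
    obtain \<tau> where \<tau>: "\<And>P k. (P, k) \<in> \<Lambda>' \<Longrightarrow>
        x P k < \<tau> P k \<and> \<tau> P k < x P (Suc k) \<and> \<tau> P k \<in> J P \<and> \<theta> P (\<tau> P k) = \<phi>"
    proof -
      have "\<forall>P k. \<exists>t. (P, k) \<in> \<Lambda>' \<longrightarrow>
          x P k < t \<and> t < x P (Suc k) \<and> t \<in> J P \<and> \<theta> P t = \<phi>"
        using hit unfolding \<Lambda>'_def mem_Collect_eq by blast
      then show ?thesis using that by metis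
    qed
    define W where "W = (\<lambda>(P, k). (P, \<tau> P k)) ` \<Lambda>'"
    have less: "\<tau> P k < \<tau> P k'" if "(P, k) \<in> \<Lambda>'" "(P, k') \<in> \<Lambda>'" "k < k'" for P k k'
    proof -
      have "P \<in> PP" "k' < M P" using that by (auto simp: \<Lambda>'_def \<Lambda>_def)
      then have "x P (Suc k) \<le> x P k'"
        using x[of P] that(3) by (auto simp: mono_on_def)
      then show ?thesis using \<tau>[OF that(1)] \<tau>[OF that(2)] by linarith
    qed
    have "inj_on (\<lambda>(P, k). (P, \<tau> P k)) \<Lambda>'"
    proof (rule inj_onI, clarsimp)
      fix P k k' assume *: "(P, k) \<in> \<Lambda>'" "(P, k') \<in> \<Lambda>'" "\<tau> P k = \<tau> P k'"
      show "k = k'"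
        using less[OF *(1,2)] less[OF *(2,1)] *(3) by (metis less_irrefl linorder_neqE_nat)
    qed
    then have card: "card \<Lambda>' = card W" by (simp add: W_def card_image)
    show ?thesis
    proof (cases "\<Lambda>' = {}")
      case True
      then show ?thesis using sum by simp
    next
      case False
      then obtain P k where Pk: "(P, k) \<in> \<Lambda>'" by auto
      have \<theta>: "\<theta> P (\<tau> P k) = \<phi>" using \<tau>[OF Pk] by simp
      then have range: "\<phi> \<in> {-(pi/2)..pi/2}"
        using arctan_bounded[of "slope P (\<tau> P k)"] by (auto simp: \<theta>_def)
      have "card W \<le> L"
      proof (rule E(2)[rule_format, of "tan \<phi>"])
        have arctan_tan: "arctan (tan \<phi>) = \<phi>" using \<theta> by (auto simp: \<theta>_def tan_arctan)
        then show "tan \<phi> \<notin> E" using \<phi> by (metis image_eqI)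
        show "finite W" using fin' by (simp add: W_def)
        fix P t assume "(P, t) \<in> W"
        then obtain k where k: "(P, k) \<in> \<Lambda>'" "t = \<tau> P k" by (auto simp: W_def)
        have "P \<in> PP" using k by (auto simp: \<Lambda>'_def \<Lambda>_def)
        moreover have "t \<in> J P" "\<theta> P t = \<phi>" using \<tau>[OF k(1)] k(2) by auto
        ultimately show "P \<noteq> {} \<and> P \<noteq> UNIV \<and> t \<in> J P \<and> slope P t = tan \<phi>"
          using PP by (auto simp: \<theta>_def tan_arctan)
      qed
      then show ?thesis unfolding sum card using range by (simp add: ennreal_of_nat_eq_real_of_nat)
    qed
  qed
  \<comment> \<open>Exceptional slopes correspond to finitely many angles, which the integral does
    not see.\<close>
  have null: "AE \<phi> in lborel. \<phi> \<notin> arctan ` E"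
    using E(1) by (intro AE_not_in finite_imp_null_set_lborel) simp
  have "ennreal (\<Sum>z\<in>\<Lambda>. hi z - lo z) = (\<Sum>z\<in>\<Lambda>. emeasure lborel {lo z<..<hi z})"
  proof -
    have "lo z \<le> hi z" for z by (cases z) (auto simp: lo_def hi_def)
    then show ?thesis by (simp add: sum_nonneg)
  qed
  also have "\<dots> = (\<Sum>z\<in>\<Lambda>. \<integral>\<^sup>+\<phi>. indicator {lo z<..<hi z} \<phi> \<partial>lborel)" by simp
  also have "\<dots> = (\<integral>\<^sup>+\<phi>. (\<Sum>z\<in>\<Lambda>. indicator {lo z<..<hi z} \<phi>) \<partial>lborel)"
    by (rule nn_integral_sum[symmetric]) simp
  also have "\<dots> \<le> (\<integral>\<^sup>+\<phi>. ennreal (real L) * indicator {-(pi/2)..pi/2} \<phi> \<partial>lborel)"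
  proof (rule nn_integral_mono_AE)
    show "AE \<phi> in lborel. (\<Sum>z\<in>\<Lambda>. indicator {lo z<..<hi z} \<phi> :: ennreal)
        \<le> ennreal (real L) * indicator {-(pi/2)..pi/2} \<phi>"
      using null by eventually_elim (rule count)
  qed
  \<comment> \<open>Slopes, unlike directed tangents, fill only a half-circle of angles.\<close>
  also have "\<dots> = ennreal (real L) * ennreal pi"
    by (simp add: nn_integral_cmult)
  also have "\<dots> = ennreal (pi * real L)" by (simp add: ennreal_mult[symmetric] mult.commute)
  finally have "(\<Sum>z\<in>\<Lambda>. hi z - lo z) \<le> pi * real L"
    by (subst (asm) ennreal_le_iff) auto
  moreover have "(\<Sum>z\<in>\<Lambda>. hi z - lo z)
      = (\<Sum>P\<in>PP. \<Sum>k<M P. \<bar>\<theta> P (x P k) - \<theta> P (x P (Suc k))\<bar>)"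
  proof -
    have "(\<Sum>P\<in>PP. \<Sum>k<M P. \<bar>\<theta> P (x P k) - \<theta> P (x P (Suc k))\<bar>)
        = (\<Sum>(P, k)\<in>\<Lambda>. \<bar>\<theta> P (x P k) - \<theta> P (x P (Suc k))\<bar>)"
      unfolding \<Lambda>_def by (rule sum.Sigma) auto
    also have "\<dots> = (\<Sum>z\<in>\<Lambda>. hi z - lo z)"
      by (rule sum.cong) (auto simp: lo_def hi_def)
    finally show ?thesis ..
  qed
  ultimately show ?thesis by (simp add: L_def \<theta>_def)
qed

lemma sum_arc_length_slope:
  assumes "\<And>P. P \<in> PP \<Longrightarrow> P \<noteq> {} \<and> P \<noteq> UNIV \<and> J P \<noteq> {}"
  shows "(\<Sum>P\<in>PP. arc_length (\<lambda>t. arctan (slope P t)) (J P))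
    \<le> ennreal (pi * real ((CARD('n) - 1) * (CARD('n) - 2)))"
proof (rule arc_length_real_le_sum)
  fix M :: "'n set \<Rightarrow> nat" and x :: "'n set \<Rightarrow> nat \<Rightarrow> real"
  assume x: "\<And>P. P \<in> PP \<Longrightarrow> mono_on {..M P} (x P) \<and> x P ` {..M P} \<subseteq> J P"
  show "(\<Sum>P\<in>PP. \<Sum>k<M P. \<bar>arctan (slope P (x P k)) - arctan (slope P (x P (Suc k)))\<bar>)
      \<le> pi * real ((CARD('n) - 1) * (CARD('n) - 2))"
    by (rule total_variation_slope) (use assms x in blast)+
qed (use assms in simp_all)

end

section \<open>Bounded cells\<close>

locale simple_line_family = line_family m k for m k :: "'n::finite \<Rightarrow> real" +
  assumes no_triple: "\<And>t s i j l. s = m i * t + k i \<Longrightarrow> s = m j * t + k j \<Longrightarrow> s = m l * t + k l \<Longrightarrow>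
    i = j \<or> l = i \<or> l = j"
begin

definition bounded_cell :: "'n set \<Rightarrow> bool" where
  "bounded_cell P \<longleftrightarrow> J P \<noteq> {} \<and> (\<exists>B. \<forall>t s. cell P t s \<longrightarrow> \<bar>t\<bar> \<le> B \<and> \<bar>s\<bar> \<le> B)"

text \<open>Below all lines, or above all lines, a cell contains a whole vertical ray.\<close>

lemma bounded_cell_proper:
  assumes "bounded_cell P"
  shows "P \<noteq> {} \<and> P \<noteq> UNIV \<and> J P \<noteq> {}"
proof -
  obtain B where B: "\<And>t s. cell P t s \<Longrightarrow> \<bar>s\<bar> \<le> B"
    using assms unfolding bounded_cell_def by blast
  obtain t s where ts: "cell P t s" using assms by (auto simp: bounded_cell_def J_def)
  have "B \<ge> 0" using B[OF ts] by linarith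
  have "P \<noteq> {}"
  proof
    assume P: "P = {}"
    \<comment> \<open>Two points at vertical distance 2B + 1 cannot both satisfy |s| <= B.\<close>
    have "q l t (s - (2 * B + 1)) < 0" for l
      using cell_neg[OF ts, of l] P \<open>B \<ge> 0\<close> by (simp add: q_def)
    then have "cell P t (s - (2 * B + 1))" using P by (simp add: cell_def)
    from B[OF this] show False using B[OF ts] \<open>B \<ge> 0\<close> by linarith
  qed
  moreover have "P \<noteq> UNIV"
  proof
    assume P: "P = UNIV"
    have "q l t (s + (2 * B + 1)) > 0" for l
      using cell_pos[OF ts, of l] P \<open>B \<ge> 0\<close> by (simp add: q_def)
    then have "cell P t (s + (2 * B + 1))" using P by (simp add: cell_def)
    from B[OF this] show False using B[OF ts] \<open>B \<ge> 0\<close> by linarith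
  qed
  ultimately show ?thesis using assms by (simp add: bounded_cell_def)
qed

section \<open>Vertices of the arrangement and the cells to their right\<close>

definition vt :: "'n \<Rightarrow> 'n \<Rightarrow> real" where
  "vt i j = (k i - k j) / (m j - m i)"

definition vs :: "'n \<Rightarrow> 'n \<Rightarrow> real" where
  "vs i j = m i * vt i j + k i"

text \<open>For \<open>m i < m j\<close> this is the sign pattern just to the right of the crossing
  of \<open>i\<close> and \<open>j\<close>, in the wedge above \<open>i\<close> and below
  \<open>j\<close>. At the vertex both \<open>q\<close>s are zero, so \<open>i\<close> has to be
  inserted by hand.\<close>

definition right_cell :: "'n \<Rightarrow> 'n \<Rightarrow> 'n set" where
  "right_cell i j = insert i {l. q l (vt i j) (vs i j) > 0}"

lemma q_vertex:
  assumes "m i < m j"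
  shows "q i (vt i j) (vs i j) = 0" "q j (vt i j) (vs i j) = 0"
proof -
  show "q i (vt i j) (vs i j) = 0" by (simp add: q_def vs_def)
  have "(m j - m i) * vt i j = k i - k j" using assms by (simp add: vt_def)
  then show "q j (vt i j) (vs i j) = 0" by (simp add: q_def vs_def algebra_simps)
qed

text \<open>Leaving the vertex to the right with the mean of the two slopes leads into the wedge.
  Every other line misses the vertex, as no three lines concur, and keeps its sign nearby.\<close>

lemma right_cell_near_vertex:
  assumes ij: "m i < m j"
  shows "eventually (\<lambda>\<epsilon>. cell (right_cell i j) (vt i j + \<epsilon>) (vs i j + \<epsilon> * ((m i + m j) / 2))) (at_right 0)"
proof -
  let ?q = "\<lambda>l \<epsilon>. q l (vt i j + \<epsilon>) (vs i j + \<epsilon> * ((m i + m j) / 2))"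
  have q: "?q l \<epsilon> = q l (vt i j) (vs i j) + \<epsilon> * ((m i + m j) / 2 - m l)" for l \<epsilon>
    by (simp add: q_def algebra_simps)
  have "eventually (\<lambda>\<epsilon>. if l \<in> right_cell i j then ?q l \<epsilon> > 0 else ?q l \<epsilon> < 0) (at_right 0)" for l
  proof -
    consider "l = i" | "l = j" | "l \<noteq> i" "l \<noteq> j" by blast
    then show ?thesis
    proof cases
      case 1
      have "eventually (\<lambda>\<epsilon>. ?q i \<epsilon> > 0) (at_right 0)"
      proof (rule eventually_mono[OF eventually_at_right_less])
        fix \<epsilon> :: real assume "0 < \<epsilon>"
        then have "0 < \<epsilon> * ((m i + m j) / 2 - m i)" using ij by (intro mult_pos_pos) auto
        then show "?q i \<epsilon> > 0" unfolding q q_vertex(1)[OF ij] by linarith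
      qed
      then show ?thesis unfolding 1 by (simp only: right_cell_def insert_iff simp_thms if_True)
    next
      case 2
      have "eventually (\<lambda>\<epsilon>. ?q j \<epsilon> < 0) (at_right 0)"
      proof (rule eventually_mono[OF eventually_at_right_less])
        fix \<epsilon> :: real assume "0 < \<epsilon>"
        then have "\<epsilon> * ((m i + m j) / 2 - m j) < 0" using ij by (intro mult_pos_neg) auto
        then show "?q j \<epsilon> < 0" unfolding q q_vertex(2)[OF ij] by linarith
      qed
      moreover have "j \<notin> right_cell i j" using ij q_vertex(2)[OF ij] by (auto simp: right_cell_def)
      ultimately show ?thesis unfolding 2 by (simp only: if_False)
    next
      case 3
      have nz: "q l (vt i j) (vs i j) \<noteq> 0"
        using no_triple[of "vs i j" i "vt i j" j l] q_vertex[OF ij] 3 ij by (auto simp: q_def)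
      have lim: "(?q l \<longlongrightarrow> q l (vt i j) (vs i j)) (at_right 0)"
        unfolding q by (rule tendsto_eq_intros refl)+ simp
      show ?thesis
      proof (cases "q l (vt i j) (vs i j) > 0")
        case True
        then show ?thesis using order_tendstoD(1)[OF lim True] by (simp only: right_cell_def insert_iff mem_Collect_eq simp_thms if_True)
      next
        case False
        then have "q l (vt i j) (vs i j) < 0" using nz by simp
        from order_tendstoD(2)[OF lim this] show ?thesis
            using False 3 by (simp only: right_cell_def insert_iff mem_Collect_eq simp_thms if_False)
      qed
    qed
  qed
  then show ?thesis unfolding cell_def by (rule eventually_all_finite)
qed

text \<open>The difference of \<open>q i\<close> and \<open>q j\<close> is (m_j - m_i) times the
  horizontal distance from the vertex, so points above \<open>i\<close> and below \<open>j\<close>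
  lie to the right of it.\<close>

lemma right_cell_wedge:
  assumes ij: "m i < m j" and "cell (right_cell i j) t s"
  shows "q i t s > 0" "q j t s < 0" "vt i j < t"
proof -
  show i: "q i t s > 0" using assms(2) by (rule cell_pos) (simp add: right_cell_def)
  have "j \<notin> right_cell i j" using ij q_vertex(2)[OF ij] by (auto simp: right_cell_def)
  with assms(2) show j: "q j t s < 0" by (rule cell_neg)
  have "(m j - m i) * vt i j = k i - k j" using ij by (simp add: vt_def)
  then have "q i t s - q j t s = (m j - m i) * (t - vt i j)" by (simp add: q_def algebra_simps)
  then have "(m j - m i) * (t - vt i j) > 0" using i j by linarith
  then show "vt i j < t" using ij by (simp add: zero_less_mult_iff)
qed

text \<open>Each vertex lies in the closure of the other's wedge, hence not to the left of the
  other. So the vertices have the same abscissa, then the same height, and the absence of triple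
  points identifies the lines.\<close>

lemma right_cell_inj:
  assumes ij: "m i < m j" and ij': "m i' < m j'" and eq: "right_cell i j = right_cell i' j'"
  shows "i = i' \<and> j = j'"
proof -
  have lim: "((\<lambda>\<epsilon>. q l (vt i j + \<epsilon>) (vs i j + \<epsilon> * ((m i + m j) / 2))) \<longlongrightarrow> q l (vt i j) (vs i j)) (at_right 0)"
    for i j l unfolding q_def by (rule tendsto_eq_intros refl)+ simp
  have closure: "q i' (vt i j) (vs i j) \<ge> 0 \<and> q j' (vt i j) (vs i j) \<le> 0 \<and> vt i' j' \<le> vt i j"
    if ij: "m i < m j" and ij': "m i' < m j'" and eq: "right_cell i j = right_cell i' j'" for i j i' j'
  proof (intro conjI)
    note near = right_cell_near_vertex[OF ij, unfolded eq]
    show i: "q i' (vt i j) (vs i j) \<ge> 0"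
      by (rule tendsto_lowerbound[OF lim]) (use near in \<open>auto elim!: eventually_mono dest: right_cell_wedge(1)[OF ij']\<close>)
    show j: "q j' (vt i j) (vs i j) \<le> 0"
      by (rule tendsto_upperbound[OF lim]) (use near in \<open>auto elim!: eventually_mono dest: right_cell_wedge(2)[OF ij']\<close>)
    have "(m j' - m i') * vt i' j' = k i' - k j'" using ij' by (simp add: vt_def)
    then have "q i' (vt i j) (vs i j) - q j' (vt i j) (vs i j) = (m j' - m i') * (vt i j - vt i' j')"
      by (simp add: q_def algebra_simps)
    then have "(m j' - m i') * (vt i j - vt i' j') \<ge> 0" using i j by linarith
    then show "vt i' j' \<le> vt i j" using ij' by (simp add: zero_le_mult_iff)
  qed
  note 1 = closure[OF ij ij' eq] and 2 = closure[OF ij' ij eq[symmetric]]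
  then have t: "vt i j = vt i' j'" by simp
  \<comment> \<open>This difference does not depend on \<open>l\<close>; taking \<open>i'\<close>
    shows that it is nonnegative, taking \<open>j'\<close> that it is nonpositive.\<close>
  have "q l (vt i j) (vs i j) - q l (vt i' j') (vs i' j') = vs i j - vs i' j'" for l
    unfolding t by (simp add: q_def)
  from this[of i'] this[of j'] have s: "vs i j = vs i' j'"
    using 1 q_vertex[OF ij'] by linarith
  have on: "vs i j = m l * vt i j + k l" if "l \<in> {i, j, i', j'}" for l
    using that q_vertex[OF ij] q_vertex[OF ij'] unfolding t s by (auto simp: q_def)
  have "i = j \<or> i' = i \<or> i' = j" "i = j \<or> j' = i \<or> j' = j"
    by (rule no_triple[OF on on on]; simp)+
  then show ?thesis using ij ij' by auto
qed

lemma unbounded_right_cell: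
  assumes ij: "m i < m j" and unb: "\<not> bounded_cell (right_cell i j)"
    and ab: "m a < m b" "b \<in> right_cell i j"
  shows "a \<in> right_cell i j"
proof -
  let ?P = "right_cell i j"
  \<comment> \<open>Where lines \<open>a\<close> and \<open>b\<close> cross. To the right of it
    \<open>a\<close> runs below \<open>b\<close>, so a point above \<open>b\<close> is also above
    \<open>a\<close>.\<close>
  define T where "T = (k a - k b) / (m b - m a)"
  define \<beta> where "\<beta> = \<bar>vt i j\<bar> + \<bar>T\<bar>"
  have "\<exists>t s. cell ?P t s \<and> T < t"
  proof (rule ccontr)
    assume "\<not> ?thesis"
    then have T: "\<And>t s. cell ?P t s \<Longrightarrow> t \<le> T" by (auto simp: not_less)
    \<comment> \<open>With \<open>t\<close> confined between the vertex and \<open>T\<close>, and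
      \<open>s\<close> between lines \<open>i\<close> and \<open>j\<close>, the cell would be
      bounded.\<close>
    have "\<bar>t\<bar> \<le> \<beta> + (\<bar>m i\<bar> + \<bar>m j\<bar>) * \<beta> + \<bar>k i\<bar> + \<bar>k j\<bar> \<and> \<bar>s\<bar> \<le> \<beta> + (\<bar>m i\<bar> + \<bar>m j\<bar>) * \<beta> + \<bar>k i\<bar> + \<bar>k j\<bar>"
      if c: "cell ?P t s" for t s
    proof -
      note w = right_cell_wedge[OF ij c]
      have t: "\<bar>t\<bar> \<le> \<beta>" using w(3) T[OF c] by (simp add: \<beta>_def)
      have "\<bar>m i * t\<bar> \<le> \<bar>m i\<bar> * \<beta>" "\<bar>m j * t\<bar> \<le> \<bar>m j\<bar> * \<beta>"
        unfolding abs_mult by (rule mult_left_mono[OF t], simp)+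
      moreover have "m i * t + k i < s" "s < m j * t + k j" using w by (simp_all add: q_def)
      moreover have "0 \<le> \<bar>m i\<bar> * \<beta>" "0 \<le> \<bar>m j\<bar> * \<beta>" by (simp_all add: \<beta>_def)
      ultimately show ?thesis using t unfolding distrib_right by linarith
    qed
    moreover obtain \<epsilon> where "cell ?P (vt i j + \<epsilon>) (vs i j + \<epsilon> * ((m i + m j) / 2))"
      using eventually_happens'[OF trivial_limit_at_right_real right_cell_near_vertex[OF ij]] by blast
    ultimately have "bounded_cell ?P" unfolding bounded_cell_def J_def by blast
    then show False using unb by simp
  qed
  then obtain t s where c: "cell ?P t s" and t: "T < t" by blast
  have "m a * t + k a < m b * t + k b" using t ab(1) by (simp add: T_def field_simps)
  moreover have "q b t s > 0" using cell_pos[OF c ab(2)] .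
  ultimately have "q a t s > 0" by (simp add: q_def)
  then show ?thesis using cell_neg[OF c, of a] by (meson less_asym)
qed

text \<open>Initial segments in the order of the slopes form a chain, so their cardinalities, from 1
  to n-1, tell them apart. The patterns of unbounded right cells are of this kind.\<close>

lemma card_slope_downsets:
  "card {P. P \<noteq> {} \<and> P \<noteq> UNIV \<and> (\<forall>a b. m a < m b \<longrightarrow> b \<in> P \<longrightarrow> a \<in> P)} \<le> CARD('n) - 1"
    (is "card ?D \<le> _")
proof -
  have "inj_on card ?D"
  proof (rule inj_onI)
    fix P Q assume PQ: "P \<in> ?D" "Q \<in> ?D" "card P = card Q"
    have "P \<subseteq> Q \<or> Q \<subseteq> P"
    proof (rule ccontr)
      assume "\<not> ?thesis"
      then obtain a b where ab: "a \<in> P" "a \<notin> Q" "b \<in> Q" "b \<notin> P" by blast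
      then have "m a \<noteq> m b" using inj_m by (metis injD)
      then show False using ab PQ(1,2) by (auto simp: neq_iff)
    qed
    then show "P = Q" using PQ(3) card_subset_eq[of Q P] card_subset_eq[of P Q] by auto
  qed
  moreover have "card ` ?D \<subseteq> {1..<CARD('n)}"
  proof (clarsimp, intro conjI)
    fix P :: "'n set" assume "P \<noteq> {}" "P \<noteq> UNIV"
    then show "Suc 0 \<le> card P" "card P < CARD('n)"
      by (auto simp: Suc_le_eq card_gt_0_iff intro!: psubset_card_mono)
  qed
  ultimately show ?thesis
    using card_inj_on_le[of card ?D "{1..<CARD('n)}"] by simp
qed

lemma card_slope_pairs: "2 * card {(i, j). m i < m j} = CARD('n) * (CARD('n) - 1)"
proof -
  let ?V = "{(i, j). m i < m j}"
  let ?V' = "{(i, j). m j < m i}"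
  let ?I = "range (\<lambda>i :: 'n. (i, i))"
  have "?V' = prod.swap ` ?V" by force
  then have swap: "card ?V' = card ?V" by (simp add: card_image)
  have tri: "m i < m j \<or> m j < m i \<or> i = j" for i j
    using inj_m by (metis injD linorder_neqE)
  have "(UNIV :: ('n \<times> 'n) set) \<subseteq> ?V \<union> ?V' \<union> ?I"
  proof
    fix z :: "'n \<times> 'n"
    show "z \<in> ?V \<union> ?V' \<union> ?I" using tri[of "fst z" "snd z"] by (cases z) auto
  qed
  then have un: "?V \<union> ?V' \<union> ?I = UNIV" by blast
  have "card (?V \<union> ?V' \<union> ?I) = card (?V \<union> ?V') + card ?I"
    by (rule card_Un_disjoint) auto
  moreover have "card (?V \<union> ?V') = card ?V + card ?V'"
    by (rule card_Un_disjoint) auto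
  moreover have "card ?I = CARD('n)"
    by (rule card_image) (simp add: inj_def)
  moreover have "card (?V \<union> ?V' \<union> ?I) = CARD('n) * CARD('n)"
    unfolding un by (rule card_prod)
  ultimately have "CARD('n) * CARD('n) = 2 * card ?V + CARD('n)" using swap by linarith
  then show ?thesis by (simp add: diff_mult_distrib2)
qed

text \<open>
  Every vertex is the leftmost point of exactly one cell. Such a cell is unbounded only if it
  reaches \<open>t = \<infinity>\<close>, where the lines are ordered by slope.
\<close>

lemma card_bounded_cells: "(CARD('n) - 1) * (CARD('n) - 2) \<le> 2 * card {P. bounded_cell P}"
proof -
  let ?R = "\<lambda>(i, j). right_cell i j"
  let ?V = "{(i, j). m i < m j}"
  let ?U = "{(i, j). m i < m j \<and> \<not> bounded_cell (right_cell i j)}"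
  let ?W = "{(i, j). m i < m j \<and> bounded_cell (right_cell i j)}"
  have inj: "inj_on ?R ?V" using right_cell_inj by (auto simp: inj_on_def)
  have "card ?U = card (?R ` ?U)"
    by (rule card_image[symmetric], rule inj_on_subset[OF inj]) auto
  also have "\<dots> \<le> card {P. P \<noteq> {} \<and> P \<noteq> UNIV \<and> (\<forall>a b. m a < m b \<longrightarrow> b \<in> P \<longrightarrow> a \<in> P)}"
  proof (rule card_mono)
    show "?R ` ?U \<subseteq> {P. P \<noteq> {} \<and> P \<noteq> UNIV \<and> (\<forall>a b. m a < m b \<longrightarrow> b \<in> P \<longrightarrow> a \<in> P)}"
    proof
      fix P assume "P \<in> ?R ` ?U"
      then obtain i j where ij: "m i < m j" "\<not> bounded_cell (right_cell i j)" and P: "P = right_cell i j"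
        by auto
      have "i \<in> P" "j \<notin> P" "\<forall>a b. m a < m b \<longrightarrow> b \<in> P \<longrightarrow> a \<in> P"
        using ij q_vertex(2)[OF ij(1)] unbounded_right_cell[OF ij]
        unfolding P by (auto simp: right_cell_def)
      then show "P \<in> {P. P \<noteq> {} \<and> P \<noteq> UNIV \<and> (\<forall>a b. m a < m b \<longrightarrow> b \<in> P \<longrightarrow> a \<in> P)}"
        by blast
    qed
  qed simp
  also have "\<dots> \<le> CARD('n) - 1" by (rule card_slope_downsets)
  finally have U: "card ?U \<le> CARD('n) - 1" .
  have "card ?W = card (?R ` ?W)"
    by (rule card_image[symmetric], rule inj_on_subset[OF inj]) auto
  also have "\<dots> \<le> card {P. bounded_cell P}" by (rule card_mono) auto
  finally have W: "card ?W \<le> card {P. bounded_cell P}" .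
  have "?V = ?U \<union> ?W" by auto
  then have "card ?V = card ?U + card ?W" by (simp add: card_Un_disjoint disjoint_iff)
  \<comment> \<open>Of the n(n-1)/2 vertices at most n-1 have an unbounded right cell, which leaves
    at least (n-1)(n-2)/2.\<close>
  then have "CARD('n) * (CARD('n) - 1) \<le> 2 * (CARD('n) - 1) + 2 * card {P. bounded_cell P}"
    using U W card_slope_pairs by linarith
  moreover have "CARD('n) * (CARD('n) - 1) = 2 * (CARD('n) - 1) + (CARD('n) - 1) * (CARD('n) - 2)"
  proof -
    obtain c where "CARD('n) = c + 3" using card_ge by (metis le_add_diff_inverse2)
    then show ?thesis by (simp add: algebra_simps)
  qed
  ultimately show ?thesis by linarith
qed

end

section \<open>Curvature of the arcs\<close>

lemma arc_length_le_of_dist_le: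
  assumes "\<And>x y. x \<in> I \<Longrightarrow> y \<in> I \<Longrightarrow> dist (g x) (g y) \<le> dist (h x) (h y)"
  shows "arc_length g I \<le> arc_length h I"
  unfolding arc_length_def
proof (rule SUP_mono, clarify)
  fix m :: nat and s :: "nat \<Rightarrow> real"
  assume s: "mono_on {..m} s" "s ` {..m} \<subseteq> I"
  have "(\<Sum>k<m. ennreal (dist (g (s k)) (g (s (Suc k))))) \<le> (\<Sum>k<m. ennreal (dist (h (s k)) (h (s (Suc k)))))"
    by (intro sum_mono ennreal_leI assms) (use s(2) in auto)
  then show "\<exists>z\<in>{(m, s). mono_on {..m} s \<and> s ` {..m} \<subseteq> I}.
      (\<Sum>k<m. ennreal (dist (g (s k)) (g (s (Suc k)))))
      \<le> (case z of (m, s) \<Rightarrow> \<Sum>k<m. ennreal (dist (h (s k)) (h (s (Suc k)))))"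
    using s by (intro bexI[of _ "(m, s)"]) auto
qed

text \<open>Partitions of \<open>I\<close> are carried to partitions of \<open>I'\<close>; if
  \<open>u\<close> is decreasing, the image has to be read backwards.\<close>

lemma arc_length_compose_monotone:
  assumes u: "u ` I \<subseteq> I'"
    and mono: "(\<forall>x\<in>I. \<forall>y\<in>I. x \<le> y \<longrightarrow> u x \<le> u y) \<or> (\<forall>x\<in>I. \<forall>y\<in>I. x \<le> y \<longrightarrow> u y \<le> u x)"
  shows "arc_length (\<lambda>x. h (u x)) I \<le> arc_length h I'"
  unfolding arc_length_def
proof (rule SUP_mono, clarify)
  fix m :: nat and s :: "nat \<Rightarrow> real"
  assume s: "mono_on {..m} s" "s ` {..m} \<subseteq> I"
  let ?X = "{(m, s). mono_on {..m} s \<and> s ` {..m} \<subseteq> I'}"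
  let ?S = "\<Sum>k<m. ennreal (dist (h (u (s k))) (h (u (s (Suc k)))))"
  show "\<exists>z\<in>?X. ?S \<le> (case z of (m, s) \<Rightarrow> \<Sum>k<m. ennreal (dist (h (s k)) (h (s (Suc k)))))"
    using mono
  proof
    assume up: "\<forall>x\<in>I. \<forall>y\<in>I. x \<le> y \<longrightarrow> u x \<le> u y"
    have "(m, \<lambda>k. u (s k)) \<in> ?X"
      using s u up by (auto simp: mono_on_def image_subset_iff)
    then show ?thesis by (rule rev_bexI) simp
  next
    assume down: "\<forall>x\<in>I. \<forall>y\<in>I. x \<le> y \<longrightarrow> u y \<le> u x"
    have "(m, \<lambda>k. u (s (m - k))) \<in> ?X"
      using s u down by (auto simp: mono_on_def image_subset_iff)
    moreover have "?S = (\<Sum>k<m. ennreal (dist (h (u (s (m - k)))) (h (u (s (m - Suc k))))))"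
    proof -
      have "?S = (\<Sum>k<m. ennreal (dist (h (u (s (m - Suc k)))) (h (u (s (Suc (m - Suc k)))))))"
        by (rule sum.nat_diff_reindex[symmetric])
      also have "\<dots> = (\<Sum>k<m. ennreal (dist (h (u (s (m - k)))) (h (u (s (m - Suc k))))))"
        by (rule sum.cong) (simp_all add: dist_commute Suc_diff_Suc)
      finally show ?thesis .
    qed
    ultimately show ?thesis by (intro rev_bexI) auto
  qed
qed

lemma connected_nonzero_sign:
  fixes h :: "real \<Rightarrow> real"
  assumes "connected I" "continuous_on I h" "\<And>x. x \<in> I \<Longrightarrow> h x \<noteq> 0"
  shows "(\<forall>x\<in>I. h x > 0) \<or> (\<forall>x\<in>I. h x < 0)"
proof (rule ccontr)
  assume "\<not> ?thesis"
  then obtain x y where xy: "x \<in> I" "y \<in> I" "h x \<le> 0" "0 \<le> h y" by (auto simp: not_less)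
  have "connected (h ` I)" using assms by (intro connected_continuous_image)
  then have "{h x..h y} \<subseteq> h ` I" using connected_contains_Icc xy(1,2) by blast
  then have "0 \<in> h ` I" using xy(3,4) by auto
  then show False using assms(3) by auto
qed

lemma strict_sign_derivative_monotone:
  fixes u :: "real \<Rightarrow> real"
  assumes I: "connected I" and u: "\<And>x. x \<in> I \<Longrightarrow> (u has_real_derivative u' x) (at x)"
    and sign: "(\<forall>x\<in>I. u' x > 0) \<or> (\<forall>x\<in>I. u' x < 0)"
  shows "(\<forall>x\<in>I. \<forall>y\<in>I. x \<le> y \<longrightarrow> u x \<le> u y) \<or> (\<forall>x\<in>I. \<forall>y\<in>I. x \<le> y \<longrightarrow> u y \<le> u x)"
  using sign
proof
  assume pos: "\<forall>x\<in>I. u' x > 0"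
  have "u x \<le> u y" if "x \<in> I" "y \<in> I" "x \<le> y" for x y
  proof (rule DERIV_nonneg_imp_nondecreasing[OF that(3)])
    fix z assume "x \<le> z" "z \<le> y"
    then have "z \<in> I" using connected_contains_Icc[OF I that(1,2)] by auto
    then show "\<exists>d. (u has_real_derivative d) (at z) \<and> 0 \<le> d"
      using u pos by (intro exI[of _ "u' z"]) (auto intro: less_imp_le)
  qed
  then show ?thesis by blast
next
  assume neg: "\<forall>x\<in>I. u' x < 0"
  have "u y \<le> u x" if "x \<in> I" "y \<in> I" "x \<le> y" for x y
  proof (rule DERIV_nonpos_imp_nonincreasing[OF that(3)])
    fix z assume "x \<le> z" "z \<le> y"
    then have "z \<in> I" using connected_contains_Icc[OF I that(1,2)] by auto
    then show "\<exists>d. (u has_real_derivative d) (at z) \<and> d \<le> 0"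
      using u neg by (intro exI[of _ "u' z"]) (auto intro: less_imp_le)
  qed
  then show ?thesis by blast
qed

section \<open>Orthonormal coordinates and tangent directions\<close>

locale orthonormal_pair =
  fixes e1 e2 :: "'v::euclidean_space"
  assumes e11: "e1 \<bullet> e1 = 1" and e22: "e2 \<bullet> e2 = 1" and e12: "e1 \<bullet> e2 = 0"
    and expand: "\<And>y. y = (y \<bullet> e1) *\<^sub>R e1 + (y \<bullet> e2) *\<^sub>R e2"
begin

lemma coords: "(t *\<^sub>R e1 + s *\<^sub>R e2) \<bullet> e1 = t" "(t *\<^sub>R e1 + s *\<^sub>R e2) \<bullet> e2 = s"
  by (simp_all add: inner_add_left e11 e22 e12 inner_commute[of e2 e1])

lemma norm_sq: "(norm (t *\<^sub>R e1 + s *\<^sub>R e2))\<^sup>2 = t\<^sup>2 + s\<^sup>2"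
  unfolding power2_norm_eq_inner inner_add_right inner_scaleR_right coords
  by (simp add: power2_eq_square)

lemma sgn_eq_direction: "sgn (e1 + x *\<^sub>R e2) = cos (arctan x) *\<^sub>R e1 + sin (arctan x) *\<^sub>R e2"
proof -
  have "(norm (e1 + x *\<^sub>R e2))\<^sup>2 = 1 + x\<^sup>2" using norm_sq[of 1 x] by simp
  then have "norm (e1 + x *\<^sub>R e2) = sqrt (1 + x\<^sup>2)" by (metis norm_ge_zero real_sqrt_unique)
  then show ?thesis
    by (simp add: sgn_div_norm cos_arctan sin_arctan scaleR_add_right divide_inverse mult.commute)
qed

text \<open>A chord of the unit circle, of length 2 |sin ((alpha - beta) / 2)|, is no longer than
  its arc.\<close>

lemma dist_direction_le:
  "dist (cos \<alpha> *\<^sub>R e1 + sin \<alpha> *\<^sub>R e2) (cos \<beta> *\<^sub>R e1 + sin \<beta> *\<^sub>R e2) \<le> \<bar>\<alpha> - \<beta>\<bar>"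
proof -
  have "(cos \<alpha> *\<^sub>R e1 + sin \<alpha> *\<^sub>R e2) - (cos \<beta> *\<^sub>R e1 + sin \<beta> *\<^sub>R e2)
      = (cos \<alpha> - cos \<beta>) *\<^sub>R e1 + (sin \<alpha> - sin \<beta>) *\<^sub>R e2"
    by (simp add: algebra_simps)
  then have "(dist (cos \<alpha> *\<^sub>R e1 + sin \<alpha> *\<^sub>R e2) (cos \<beta> *\<^sub>R e1 + sin \<beta> *\<^sub>R e2))\<^sup>2
      = (cos \<alpha> - cos \<beta>)\<^sup>2 + (sin \<alpha> - sin \<beta>)\<^sup>2"
    by (simp add: dist_norm norm_sq)
  also have "\<dots> = 2 - 2 * cos (\<alpha> - \<beta>)"
    using sin_cos_squared_add[of \<alpha>] sin_cos_squared_add[of \<beta>]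
    by (simp add: cos_diff power2_diff algebra_simps)
  also have "\<dots> = (2 * sin ((\<alpha> - \<beta>) / 2))\<^sup>2"
  proof -
    define w where "w = (\<alpha> - \<beta>) / 2"
    have "\<alpha> - \<beta> = 2 * w" by (simp add: w_def)
    then show ?thesis using cos_double_sin[of w] by (simp add: power_mult_distrib)
  qed
  also have "\<dots> \<le> (\<alpha> - \<beta>)\<^sup>2"
    using abs_sin_x_le_abs_x[of "(\<alpha> - \<beta>) / 2"]
    by (subst abs_le_square_iff[symmetric]) (simp add: abs_mult)
  finally show ?thesis by (simp add: abs_le_square_iff[symmetric])
qed

end

locale planar_lines = simple_line_family m k + orthonormal_pair e1 e2
  for m k :: "'n::finite \<Rightarrow> real" and e1 e2 :: "real^2"
begin

definition region :: "'n set \<Rightarrow> (real^2) set" where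
  "region P = {y. cell P (y \<bullet> e1) (y \<bullet> e2)}"

definition arc :: "'n set \<Rightarrow> real \<Rightarrow> real^2" where
  "arc P t = t *\<^sub>R e1 + \<sigma> P t *\<^sub>R e2"

lemma region_empty_iff: "region P = {} \<longleftrightarrow> J P = {}"
proof -
  have "t *\<^sub>R e1 + s *\<^sub>R e2 \<in> region P" if "cell P t s" for t s
    using that by (simp add: region_def coords)
  moreover have "y \<bullet> e1 \<in> J P" if "y \<in> region P" for y using that by (auto simp: region_def J_def)
  ultimately show ?thesis unfolding J_def by blast
qed

lemma inj_region: "inj_on region {P. J P \<noteq> {}}"
proof (rule inj_onI)
  fix P P' assume "P \<in> {P. J P \<noteq> {}}" and eq: "region P = region P'"
  then obtain y where "y \<in> region P" using region_empty_iff by blast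
  then show "P = P'" using eq cell_inj unfolding region_def by blast
qed

text \<open>Disjoint nonempty open connected sets covering the complement of the lines are its
  components; connectedness comes from convexity of the cells.\<close>

lemma components_eq_regions:
  "components (- (\<Union>i. {y. q i (y \<bullet> e1) (y \<bullet> e2) = 0})) = region ` {P. J P \<noteq> {}}"
proof (rule components_open_unique)
  show "pairwise disjnt (region ` {P. J P \<noteq> {}})"
  proof (rule pairwiseI)
    fix X Y assume "X \<in> region ` {P. J P \<noteq> {}}" "Y \<in> region ` {P. J P \<noteq> {}}" "X \<noteq> Y"
    then obtain P P' where PP': "X = region P" "Y = region P'" "P \<noteq> P'" by blast
    then show "disjnt X Y" using cell_inj[of P _ _ P'] by (auto simp: disjnt_def region_def)
  qed
  show "\<Union> (region ` {P. J P \<noteq> {}}) = - (\<Union>i. {y. q i (y \<bullet> e1) (y \<bullet> e2) = 0})"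
  proof (intro equalityI subsetI)
    fix y assume "y \<in> - (\<Union>i. {y. q i (y \<bullet> e1) (y \<bullet> e2) = 0})"
    then have nz: "q i (y \<bullet> e1) (y \<bullet> e2) \<noteq> 0" for i by auto
    define P where "P = {i. q i (y \<bullet> e1) (y \<bullet> e2) > 0}"
    have "cell P (y \<bullet> e1) (y \<bullet> e2)" using nz by (auto simp: cell_def P_def neq_iff)
    then have "y \<in> region P" by (simp add: region_def)
    moreover from this have "J P \<noteq> {}" using region_empty_iff by blast
    ultimately show "y \<in> \<Union> (region ` {P. J P \<noteq> {}})" by blast
  next
    fix y assume "y \<in> \<Union> (region ` {P. J P \<noteq> {}})"
    then obtain P where "cell P (y \<bullet> e1) (y \<bullet> e2)" by (auto simp: region_def)
    from cell_nonzero[OF this] show "y \<in> - (\<Union>i. {y. q i (y \<bullet> e1) (y \<bullet> e2) = 0})" by simp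
  qed
  fix X assume "X \<in> region ` {P. J P \<noteq> {}}"
  then show "open X \<and> connected X \<and> X \<noteq> {}"
    using region_empty_iff open_cell convex_cell convex_connected unfolding region_def by blast
qed

lemma bounded_region_iff:
  assumes "J P \<noteq> {}"
  shows "bounded (region P) \<longleftrightarrow> bounded_cell P"
proof
  assume "bounded (region P)"
  then obtain B where B: "\<And>y. y \<in> region P \<Longrightarrow> norm y \<le> B" by (auto simp: bounded_iff)
  have "\<bar>t\<bar> \<le> B \<and> \<bar>s\<bar> \<le> B" if "cell P t s" for t s
  proof -
    let ?y = "t *\<^sub>R e1 + s *\<^sub>R e2"
    have "norm ?y \<le> B" using that by (intro B) (simp add: region_def coords)
    moreover have "\<bar>t\<bar> \<le> norm ?y" "\<bar>s\<bar> \<le> norm ?y"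
      by (rule power2_le_imp_le; simp add: norm_sq)+
    ultimately show ?thesis by linarith
  qed
  then show "bounded_cell P" using assms unfolding bounded_cell_def by blast
next
  assume "bounded_cell P"
  then obtain B where B: "\<And>t s. cell P t s \<Longrightarrow> \<bar>t\<bar> \<le> B \<and> \<bar>s\<bar> \<le> B"
    unfolding bounded_cell_def by blast
  have ne: "norm e1 = 1" "norm e2 = 1" using e11 e22 by (simp_all add: norm_eq_sqrt_inner)
  have "norm y \<le> 2 * B" if "y \<in> region P" for y
  proof -
    have "norm ((y \<bullet> e1) *\<^sub>R e1 + (y \<bullet> e2) *\<^sub>R e2) \<le> \<bar>y \<bullet> e1\<bar> + \<bar>y \<bullet> e2\<bar>"
      using norm_triangle_ineq[of "(y \<bullet> e1) *\<^sub>R e1" "(y \<bullet> e2) *\<^sub>R e2"] by (simp add: ne)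
    then show ?thesis using B[of "y \<bullet> e1" "y \<bullet> e2"] that expand[of y] by (simp add: region_def)
  qed
  then show "bounded (region P)" unfolding bounded_iff by blast
qed

context
  fixes P :: "'n set"
  assumes P: "P \<noteq> {}" "P \<noteq> UNIV"
begin

lemma curve_inter_region: "{y. poly2 F (y \<bullet> e1) (y \<bullet> e2) = 0} \<inter> region P = arc P ` J P"
proof (intro equalityI subsetI)
  fix y assume y: "y \<in> {y. poly2 F (y \<bullet> e1) (y \<bullet> e2) = 0} \<inter> region P"
  then have c: "cell P (y \<bullet> e1) (y \<bullet> e2)" by (simp add: region_def)
  then have J: "y \<bullet> e1 \<in> J P" by (auto simp: J_def)
  have "y \<bullet> e2 = \<sigma> P (y \<bullet> e1)" using sigma_unique[OF P J c] y by simp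
  then have "y = arc P (y \<bullet> e1)" using expand[of y] by (simp add: arc_def)
  then show "y \<in> arc P ` J P" using J by blast
next
  fix y assume "y \<in> arc P ` J P"
  then show "y \<in> {y. poly2 F (y \<bullet> e1) (y \<bullet> e2) = 0} \<inter> region P"
    using sigma_cell[OF P] sigma_F[OF P] by (auto simp: arc_def region_def coords)
qed

lemma arc_has_vector_derivative:
  assumes "t \<in> J P"
  shows "(arc P has_vector_derivative (e1 + slope P t *\<^sub>R e2)) (at t)"
proof -
  have "((\<lambda>t. t *\<^sub>R e1) has_vector_derivative 1 *\<^sub>R e1) (at t)"
    by (auto intro!: derivative_eq_intros)
  moreover have "((\<lambda>t. \<sigma> P t *\<^sub>R e2) has_vector_derivative slope P t *\<^sub>R e2) (at t)"
    using sigma_has_derivative[OF P assms]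
    by (auto intro!: derivative_eq_intros)
  ultimately show ?thesis
    unfolding arc_def by (auto dest: has_vector_derivative_add)
qed

text \<open>The existence of one regular parametrization rules out the default value infinity in
  \<open>curve_total_curvature\<close>.\<close>

lemma regular_parametrization_arc: "regular_parametrization (arc P) (J P) (arc P ` J P)"
  unfolding regular_parametrization_def
proof (intro conjI ballI)
  show "arc P C1_differentiable_on J P"
    unfolding C1_differentiable_on_def
    by (intro exI[of _ "\<lambda>t. e1 + slope P t *\<^sub>R e2"] conjI ballI arc_has_vector_derivative)
      (auto intro!: continuous_intros continuous_slope[OF P])
  show "vector_derivative (arc P) (at t) \<noteq> 0" if "t \<in> J P" for t
  proof -
    have "vector_derivative (arc P) (at t) = 1 *\<^sub>R e1 + slope P t *\<^sub>R e2"
      using vector_derivative_at[OF arc_has_vector_derivative[OF that]] by simp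
    then show ?thesis using coords(1)[of 1 "slope P t"] by auto
  qed
  show "inj_on (arc P) (J P)"
    by (rule inj_on_inverseI[of _ "\<lambda>y. y \<bullet> e1"]) (simp add: arc_def coords)
qed (simp_all add: open_J connected_J)

text \<open>Any parametrization is the graph one composed with its \<open>e1\<close>-coordinate
  \<open>u\<close>. Its derivative is \<open>u'\<close> times a vector (1, slope), so regularity
  keeps \<open>u'\<close> away from 0 and, by continuity, of one sign. Hence \<open>u\<close> is
  monotone, and up to a constant sign the Gauss image is the direction of angle
  \<open>arctan (slope P (u x))\<close>.\<close>

lemma total_curvature_regular_parametrization:
  assumes "regular_parametrization f I (arc P ` J P)"
  shows "total_curvature f I \<le> arc_length (\<lambda>t. arctan (slope P t)) (J P)"
proof -
  have I: "open I" "connected I" and C1: "f C1_differentiable_on I"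
    and nz: "\<And>x. x \<in> I \<Longrightarrow> vector_derivative f (at x) \<noteq> 0" and im: "f ` I = arc P ` J P"
    using assms by (auto simp: regular_parametrization_def)
  obtain D where D: "\<And>x. x \<in> I \<Longrightarrow> (f has_vector_derivative D x) (at x)" "continuous_on I D"
    using C1 unfolding C1_differentiable_on_def by blast
  define u where "u x = f x \<bullet> e1" for x
  define u' where "u' x = D x \<bullet> e1" for x
  have f: "u x \<in> J P \<and> f x = arc P (u x)" if x: "x \<in> I" for x
  proof -
    obtain t where "t \<in> J P" "f x = arc P t" using im x by (metis imageE imageI)
    moreover from this have "u x = t" by (simp add: u_def arc_def coords)
    ultimately show ?thesis by simp
  qed
  have u: "(u has_real_derivative u' x) (at x)" if "x \<in> I" for x
    unfolding u_def u'_def has_real_derivative_iff_has_vector_derivative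
    using bounded_linear.has_vector_derivative[OF bounded_linear_inner_left D(1)[OF that]] .
  have Deq: "D x = u' x *\<^sub>R (e1 + slope P (u x) *\<^sub>R e2)" if x: "x \<in> I" for x
  proof -
    have "((arc P \<circ> u) has_vector_derivative u' x *\<^sub>R (e1 + slope P (u x) *\<^sub>R e2)) (at x)"
      using u[OF x, unfolded has_real_derivative_iff_has_vector_derivative] arc_has_vector_derivative f[OF x]
      by (intro vector_diff_chain_at) auto
    then have "(f has_vector_derivative u' x *\<^sub>R (e1 + slope P (u x) *\<^sub>R e2)) (at x)"
      by (rule has_vector_derivative_transform_within_open[OF _ I(1) x]) (simp add: f)
    then show ?thesis using D(1)[OF x] vector_derivative_unique_at by blast
  qed
  have Dv: "vector_derivative f (at x) = D x" if "x \<in> I" for x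
    using vector_derivative_at[OF D(1)[OF that]] .
  have "u' x \<noteq> 0" if "x \<in> I" for x
    using nz[OF that] Dv[OF that] Deq[OF that] by auto
  moreover have "continuous_on I u'" unfolding u'_def by (intro continuous_intros D(2))
  ultimately have sign: "(\<forall>x\<in>I. u' x > 0) \<or> (\<forall>x\<in>I. u' x < 0)"
    using connected_nonzero_sign[OF I(2)] by blast
  define dir where "dir \<alpha> = cos \<alpha> *\<^sub>R e1 + sin \<alpha> *\<^sub>R e2" for \<alpha>
  have gauss: "gauss_map f x = sgn (u' x) *\<^sub>R dir (arctan (slope P (u x)))" if "x \<in> I" for x
    unfolding gauss_map_def Dv[OF that] Deq[OF that] dir_def by (simp add: sgn_scaleR sgn_eq_direction)
  have "arc_length (gauss_map f) I \<le> arc_length (\<lambda>x. arctan (slope P (u x))) I"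
  proof (rule arc_length_le_of_dist_le)
    fix x y assume xy: "x \<in> I" "y \<in> I"
    define \<epsilon> where "\<epsilon> = sgn (u' x)"
    have "u' x \<noteq> 0" "u' y \<noteq> 0" "sgn (u' x) = sgn (u' y)" using sign xy by auto
    then have \<epsilon>: "\<bar>\<epsilon>\<bar> = 1" "sgn (u' x) = \<epsilon>" "sgn (u' y) = \<epsilon>" by (simp_all add: \<epsilon>_def abs_sgn_eq)
    have "dist (gauss_map f x) (gauss_map f y)
        = dist (dir (arctan (slope P (u x)))) (dir (arctan (slope P (u y))))"
      using xy \<epsilon> by (simp add: gauss dist_norm scaleR_diff_right[symmetric] del: scaleR_diff_right)
    then show "dist (gauss_map f x) (gauss_map f y) \<le> dist (arctan (slope P (u x))) (arctan (slope P (u y)))"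
      using dist_direction_le unfolding dir_def by (simp add: dist_real_def)
  qed
  also have "\<dots> \<le> arc_length (\<lambda>t. arctan (slope P t)) (J P)"
    by (rule arc_length_compose_monotone)
      (use f strict_sign_derivative_monotone[OF I(2) u sign] in auto)
  finally show ?thesis by (simp add: total_curvature_def)
qed

lemma curve_total_curvature_arc:
  "curve_total_curvature (arc P ` J P) \<le> arc_length (\<lambda>t. arctan (slope P t)) (J P)"
proof -
  have "\<exists>f I. regular_parametrization f I (arc P ` J P)"
    using regular_parametrization_arc by blast
  then show ?thesis
    unfolding curve_total_curvature_def
    by (auto intro!: SUP_least total_curvature_regular_parametrization)
qed

end

lemma average_bound:
  defines "BR \<equiv> {R \<in> components (- (\<Union>i. {y. q i (y \<bullet> e1) (y \<bullet> e2) = 0})). bounded R}"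
  shows "(\<Sum>R\<in>BR. curve_total_curvature ({y. poly2 F (y \<bullet> e1) (y \<bullet> e2) = 0} \<inter> R)) / of_nat (card BR)
    \<le> ennreal (2 * pi)"
proof -
  let ?B = "{P. bounded_cell P}" and ?C = "{y. poly2 F (y \<bullet> e1) (y \<bullet> e2) = 0}"
  have J: "J P \<noteq> {}" if "bounded_cell P" for P using that by (simp add: bounded_cell_def)
  have BR: "BR = region ` ?B"
    unfolding BR_def components_eq_regions using bounded_region_iff J by blast
  have inj: "inj_on region ?B"
    by (rule inj_on_subset[OF inj_region]) (use J in blast)
  have card: "card BR = card ?B" unfolding BR by (rule card_image[OF inj])
  have "(\<Sum>R\<in>BR. curve_total_curvature (?C \<inter> R)) = (\<Sum>P\<in>?B. curve_total_curvature (?C \<inter> region P))"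
    unfolding BR by (simp add: sum.reindex[OF inj])
  also have "\<dots> \<le> (\<Sum>P\<in>?B. arc_length (\<lambda>t. arctan (slope P t)) (J P))"
  proof (rule sum_mono)
    fix P assume "P \<in> ?B"
    then have P: "P \<noteq> {}" "P \<noteq> UNIV" using bounded_cell_proper by auto
    show "curve_total_curvature (?C \<inter> region P) \<le> arc_length (\<lambda>t. arctan (slope P t)) (J P)"
      unfolding curve_inter_region[OF P] by (rule curve_total_curvature_arc[OF P])
  qed
  also have "\<dots> \<le> ennreal (pi * real ((CARD('n) - 1) * (CARD('n) - 2)))"
    by (rule sum_arc_length_slope) (use bounded_cell_proper in auto)
  also have "\<dots> \<le> ennreal (pi * real (2 * card ?B))"
    by (intro ennreal_leI mult_left_mono of_nat_mono card_bounded_cells) simp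
  also have "\<dots> = ennreal (2 * pi) * of_nat (card BR)"
    by (simp add: card ennreal_of_nat_eq_real_of_nat ennreal_mult[symmetric] mult_ac)
  finally have le: "(\<Sum>R\<in>BR. curve_total_curvature (?C \<inter> R)) \<le> ennreal (2 * pi) * of_nat (card BR)" .
  \<comment> \<open>For n >= 3 bounded cells exist, so the average divides by a positive
    number.\<close>
  have "0 < (CARD('n) - 1) * (CARD('n) - 2)" using card_ge by simp
  then have "0 < card BR" using card_bounded_cells unfolding card by linarith
  then show ?thesis using le by (intro divide_le_posI_ennreal) (simp_all add: mult.commute)
qed

end

section \<open>Generic arrangements\<close>

no_notation Matrix.vec_index (infixl "$" 100)

definition line_det :: "real^'n^2 \<Rightarrow> 'n \<Rightarrow> 'n \<Rightarrow> real" where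
  "line_det a i j = a $ 1 $ i * a $ 2 $ j - a $ 2 $ i * a $ 1 $ j"

text \<open>If it is nonzero, the normal of line \<open>i\<close> is not parallel to
  \<open>b\<close>, so the line is a graph over the \<open>t\<close>-axis. It is also the weight of
  summand \<open>i\<close> in the central curve.\<close>

definition cost_det :: "real^'n^2 \<Rightarrow> real^2 \<Rightarrow> 'n \<Rightarrow> real" where
  "cost_det a b i = b $ 1 * a $ 2 $ i - b $ 2 * a $ 1 $ i"

text \<open>The 3x3 determinant with rows (a_1i, a_2i, c_i), expanded along the last column. At a
  common point of the three lines that column is a combination of the other two.\<close>

definition concurrency_det :: "real^'n^2 \<Rightarrow> real^'n \<Rightarrow> 'n \<Rightarrow> 'n \<Rightarrow> 'n \<Rightarrow> real" where
  "concurrency_det a c i j l = c $ i * line_det a j l + c $ j * line_det a l i + c $ l * line_det a i j"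

lemma concurrency_det_eq_0:
  assumes "affine_form a c i y = 0" "affine_form a c j y = 0" "affine_form a c l y = 0"
  shows "concurrency_det a c i j l = 0"
proof -
  have c: "c $ i = a $ 1 $ i * y $ 1 + a $ 2 $ i * y $ 2" "c $ j = a $ 1 $ j * y $ 1 + a $ 2 $ j * y $ 2"
    "c $ l = a $ 1 $ l * y $ 1 + a $ 2 $ l * y $ 2"
    using assms by (simp_all add: affine_form_def)
  show ?thesis unfolding concurrency_det_def line_det_def c by (simp add: algebra_simps)
qed

text \<open>The three families of determinants provide, in this order, lines that are graphs over
  the \<open>t\<close>-axis, distinct slopes and the absence of triple points.\<close>

lemma average_total_curvature_le:
  fixes a :: "real^'n::finite^2"
  assumes card: "CARD('n) \<ge> 3"
    and cost: "\<And>i. cost_det a b i \<noteq> 0"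
    and slopes: "\<And>i j. i \<noteq> j \<Longrightarrow> line_det a i j \<noteq> 0"
    and triples: "\<And>i j l. i \<noteq> j \<Longrightarrow> l \<noteq> i \<Longrightarrow> l \<noteq> j \<Longrightarrow> concurrency_det a c i j l \<noteq> 0"
  shows "average_total_curvature a c b \<le> ennreal (2 * pi)"
proof -
  define r where "r = norm b"
  have "b \<noteq> 0" using cost by (auto simp: cost_det_def)
  then have r: "r > 0" by (simp add: r_def)
  have r2: "b $ 1 * b $ 1 + b $ 2 * b $ 2 = r * r"
    using power2_norm_eq_inner[of b] by (simp add: r_def inner_vec_def sum_2 power2_eq_square)
  \<comment> \<open>The unit vector along \<open>b\<close> and its rotation by a right angle, so
    that the level lines of the cost become \<open>t\<close> constant.\<close>
  define e1 :: "real^2" where "e1 = vector [b $ 1 / r, b $ 2 / r]"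
  define e2 :: "real^2" where "e2 = vector [- b $ 2 / r, b $ 1 / r]"
  have ye1: "y \<bullet> e1 = (b $ 1 * y $ 1 + b $ 2 * y $ 2) / r"
    and ye2: "y \<bullet> e2 = (b $ 1 * y $ 2 - b $ 2 * y $ 1) / r" for y
    by (simp_all add: e1_def e2_def inner_vec_def sum_2 add_divide_distrib diff_divide_distrib mult.commute)
  define m where "m i = - (b $ 1 * a $ 1 $ i + b $ 2 * a $ 2 $ i) / cost_det a b i" for i
  define k where "k i = r * c $ i / cost_det a b i" for i
  have scale: "d / r * (S / r - - A / d * (T / r) - r * C / d) = (d * S + A * T) / (r * r) - C"
    if "d \<noteq> 0" "r \<noteq> 0" for d r S A T C :: real
    using that by (simp add: field_simps)
  have form: "affine_form a c i y = cost_det a b i / r * (y \<bullet> e2 - m i * (y \<bullet> e1) - k i)" for i y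
  proof -
    have "cost_det a b i / r * (y \<bullet> e2 - m i * (y \<bullet> e1) - k i)
        = (cost_det a b i * (b $ 1 * y $ 2 - b $ 2 * y $ 1)
           + (b $ 1 * a $ 1 $ i + b $ 2 * a $ 2 $ i) * (b $ 1 * y $ 1 + b $ 2 * y $ 2)) / (r * r) - c $ i"
      unfolding ye1 ye2 m_def k_def using r cost[of i] by (intro scale) simp_all
    also have "cost_det a b i * (b $ 1 * y $ 2 - b $ 2 * y $ 1)
           + (b $ 1 * a $ 1 $ i + b $ 2 * a $ 2 $ i) * (b $ 1 * y $ 1 + b $ 2 * y $ 2)
        = (b $ 1 * b $ 1 + b $ 2 * b $ 2) * (a $ 1 $ i * y $ 1 + a $ 2 $ i * y $ 2)"
      unfolding cost_det_def by (simp add: algebra_simps)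
    finally show ?thesis using r by (simp add: r2 affine_form_def)
  qed
  have e11: "e1 \<bullet> e1 = 1" and e22: "e2 \<bullet> e2 = 1" and e12: "e1 \<bullet> e2 = 0"
    using r r2 unfolding ye1 ye2 by (simp_all add: e1_def e2_def field_simps)
  have expand: "y = (y \<bullet> e1) *\<^sub>R e1 + (y \<bullet> e2) *\<^sub>R e2" for y :: "real^2"
  proof -
    define A B where "A = b $ 1 * y $ 1 + b $ 2 * y $ 2" and "B = b $ 1 * y $ 2 - b $ 2 * y $ 1"
    have AB: "y \<bullet> e1 = A / r" "y \<bullet> e2 = B / r" by (simp_all add: ye1 ye2 A_def B_def)
    have "((y \<bullet> e1) *\<^sub>R e1 + (y \<bullet> e2) *\<^sub>R e2) $ 1 = (A * b $ 1 - B * b $ 2) / (r * r)"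
      unfolding AB by (simp add: e1_def e2_def diff_divide_distrib)
    also have "A * b $ 1 - B * b $ 2 = (b $ 1 * b $ 1 + b $ 2 * b $ 2) * y $ 1"
      by (simp add: A_def B_def algebra_simps)
    finally have 1: "((y \<bullet> e1) *\<^sub>R e1 + (y \<bullet> e2) *\<^sub>R e2) $ 1 = y $ 1" using r by (simp add: r2)
    have "((y \<bullet> e1) *\<^sub>R e1 + (y \<bullet> e2) *\<^sub>R e2) $ 2 = (A * b $ 2 + B * b $ 1) / (r * r)"
      unfolding AB by (simp add: e1_def e2_def add_divide_distrib)
    also have "A * b $ 2 + B * b $ 1 = (b $ 1 * b $ 1 + b $ 2 * b $ 2) * y $ 2"
      by (simp add: A_def B_def algebra_simps)
    finally have 2: "((y \<bullet> e1) *\<^sub>R e1 + (y \<bullet> e2) *\<^sub>R e2) $ 2 = y $ 2" using r by (simp add: r2)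
    show ?thesis unfolding Finite_Cartesian_Product.vec_eq_iff forall_2 1 2 by simp
  qed
  have inj: "inj m"
  proof (rule injI, rule ccontr)
    fix i j assume eq: "m i = m j" and "i \<noteq> j"
    have "(b $ 1 * a $ 1 $ i + b $ 2 * a $ 2 $ i) * cost_det a b j
        = (b $ 1 * a $ 1 $ j + b $ 2 * a $ 2 $ j) * cost_det a b i"
      using eq cost[of i] cost[of j] by (simp add: m_def field_simps)
    \<comment> \<open>Makes the difference of two slopes a nonzero multiple of
      \<open>line_det\<close>.\<close>
    moreover have "(b $ 1 * a $ 1 $ i + b $ 2 * a $ 2 $ i) * cost_det a b j
        - (b $ 1 * a $ 1 $ j + b $ 2 * a $ 2 $ j) * cost_det a b i
        = (b $ 1 * b $ 1 + b $ 2 * b $ 2) * line_det a i j"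
      unfolding cost_det_def line_det_def by (simp add: algebra_simps)
    ultimately have "r * r * line_det a i j = 0" unfolding r2 by simp
    then show False using r slopes[OF \<open>i \<noteq> j\<close>] by simp
  qed
  interpret orthonormal_pair e1 e2
    by standard (fact e11 e22 e12 expand)+
  interpret planar_lines m k e1 e2
  proof
    fix t s i j l
    assume s: "s = m i * t + k i" "s = m j * t + k j" "s = m l * t + k l"
    show "i = j \<or> l = i \<or> l = j"
    proof (rule ccontr)
      assume *: "\<not> (i = j \<or> l = i \<or> l = j)"
      define y where "y = t *\<^sub>R e1 + s *\<^sub>R e2"
      have "affine_form a c i y = 0" "affine_form a c j y = 0" "affine_form a c l y = 0"
        unfolding form y_def coords using s by simp_all
      then have "concurrency_det a c i j l = 0" by (rule concurrency_det_eq_0)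
      then show False using triples * by blast
    qed
  qed (fact inj card)+
  have form_q: "affine_form a c i y = cost_det a b i / r * q i (y \<bullet> e1) (y \<bullet> e2)" for i y
    by (simp add: form q_def)
  have line: "line a c i = {y. q i (y \<bullet> e1) (y \<bullet> e2) = 0}" for i
  proof -
    have "line a c i = {y. affine_form a c i y = 0}" by (simp add: line_def affine_form_def)
    then show ?thesis using r cost[of i] by (simp add: form_q)
  qed
  have curve: "central_curve a c b = {y. poly2 F (y \<bullet> e1) (y \<bullet> e2) = 0}"
  proof -
    \<comment> \<open>Up to \<open>r\<close>, the weight \<open>cost_det a b i\<close> is exactly
      the scale factor of the form omitted from summand \<open>i\<close>. All summands then carry
      the same constant, which is why \<open>F\<close> has equal weights.\<close>
    have "(\<Sum>i\<in>UNIV. cost_det a b i * (\<Prod>j\<in>UNIV - {i}. affine_form a c j y))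
        = r * (\<Prod>j\<in>UNIV. cost_det a b j / r) * poly2 F (y \<bullet> e1) (y \<bullet> e2)" for y
      unfolding poly2_F sum_distrib_left
    proof (rule sum.cong)
      fix i
      have "(\<Prod>j\<in>UNIV. cost_det a b j / r) = cost_det a b i / r * (\<Prod>j\<in>UNIV - {i}. cost_det a b j / r)"
        by (rule prod.remove) simp_all
      then show "cost_det a b i * (\<Prod>j\<in>UNIV - {i}. affine_form a c j y)
          = r * (\<Prod>j\<in>UNIV. cost_det a b j / r) * (\<Prod>j\<in>UNIV - {i}. q j (y \<bullet> e1) (y \<bullet> e2))"
        using r by (simp only: form_q prod.distrib) simp
    qed simp
    moreover have "r * (\<Prod>j\<in>UNIV. cost_det a b j / r) \<noteq> 0" using r cost by simp
    ultimately show ?thesis by (simp add: central_curve_def cost_det_def[symmetric])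
  qed
  show ?thesis
    using average_bound
    unfolding average_total_curvature_def bounded_regions_def regions_def line curve .
qed

section \<open>Genericity: the exceptional hypersurface and a point outside it\<close>

lemma real_polynomial_function_generic:
  fixes i j l :: "'n::finite"
  shows "real_polynomial_function (\<lambda>x :: (real^'n^2) \<times> (real^'n) \<times> (real^2). cost_det (fst x) (snd (snd x)) i)"
    and "real_polynomial_function (\<lambda>x :: (real^'n^2) \<times> (real^'n) \<times> (real^2). line_det (fst x) i j)"
    and "real_polynomial_function (\<lambda>x :: (real^'n^2) \<times> (real^'n) \<times> (real^2). concurrency_det (fst x) (fst (snd x)) i j l)"
proof -
  have a: "real_polynomial_function (\<lambda>x :: (real^'n^2) \<times> (real^'n) \<times> (real^2). fst x $ h $ i)" for h i
    by (intro real_polynomial_function.intros(1) bounded_linear_compose[OF bounded_linear_vec_nth]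
        bounded_linear_fst)
  have c: "real_polynomial_function (\<lambda>x :: (real^'n^2) \<times> (real^'n) \<times> (real^2). fst (snd x) $ i)" for i
    by (intro real_polynomial_function.intros(1) bounded_linear_compose[OF bounded_linear_vec_nth]
        bounded_linear_compose[OF bounded_linear_fst] bounded_linear_snd)
  have b: "real_polynomial_function (\<lambda>x :: (real^'n^2) \<times> (real^'n) \<times> (real^2). snd (snd x) $ h)" for h
    by (intro real_polynomial_function.intros(1) bounded_linear_compose[OF bounded_linear_vec_nth]
        bounded_linear_compose[OF bounded_linear_snd] bounded_linear_snd)
  show "real_polynomial_function (\<lambda>x :: (real^'n^2) \<times> (real^'n) \<times> (real^2). cost_det (fst x) (snd (snd x)) i)"
    and "real_polynomial_function (\<lambda>x :: (real^'n^2) \<times> (real^'n) \<times> (real^2). line_det (fst x) i j)"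
    and "real_polynomial_function (\<lambda>x :: (real^'n^2) \<times> (real^'n) \<times> (real^2). concurrency_det (fst x) (fst (snd x)) i j l)"
    unfolding cost_det_def line_det_def concurrency_det_def
    by (intro real_polynomial_function.intros(2-4) real_polynomial_function_diff a b c)+
qed

theorem theorem7:
  assumes "CARD('n::finite) \<ge> 3"
  shows "generically (\<lambda>(a :: real^'n^2, c :: real^'n, b :: real^2).
           average_total_curvature a c b \<le> ennreal (2 * pi))"
proof -
  \<comment> \<open>All conditions are multiplied into one polynomial, so a single point where it is
    nonzero shows that its zero set is proper.\<close>
  define p1 p2 p3 p :: "(real^'n^2) \<times> (real^'n) \<times> (real^2) \<Rightarrow> real" where
    "p1 x = (\<Prod>i\<in>UNIV. cost_det (fst x) (snd (snd x)) i)" and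
    "p2 x = (\<Prod>z\<in>{z. fst z \<noteq> snd z}. line_det (fst x) (fst z) (snd z))" and
    "p3 x = (\<Prod>z\<in>{z. fst z \<noteq> fst (snd z) \<and> snd (snd z) \<noteq> fst z \<and> snd (snd z) \<noteq> fst (snd z)}.
      concurrency_det (fst x) (fst (snd x)) (fst z) (fst (snd z)) (snd (snd z)))" and
    "p x = p1 x * p2 x * p3 x" for x
  have p: "p x \<noteq> 0 \<longleftrightarrow> (\<forall>i. cost_det (fst x) (snd (snd x)) i \<noteq> 0) \<and> (\<forall>i j. i \<noteq> j \<longrightarrow> line_det (fst x) i j \<noteq> 0)
      \<and> (\<forall>i j l. i \<noteq> j \<longrightarrow> l \<noteq> i \<longrightarrow> l \<noteq> j \<longrightarrow> concurrency_det (fst x) (fst (snd x)) i j l \<noteq> 0)" for x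
  proof -
    have "p1 x \<noteq> 0 \<longleftrightarrow> (\<forall>i. cost_det (fst x) (snd (snd x)) i \<noteq> 0)"
      by (simp add: p1_def)
    moreover have "p2 x \<noteq> 0 \<longleftrightarrow> (\<forall>i j. i \<noteq> j \<longrightarrow> line_det (fst x) i j \<noteq> 0)"
      by (simp add: p2_def Ball_def split_paired_All) blast
    moreover have "p3 x \<noteq> 0 \<longleftrightarrow>
        (\<forall>i j l. i \<noteq> j \<longrightarrow> l \<noteq> i \<longrightarrow> l \<noteq> j \<longrightarrow> concurrency_det (fst x) (fst (snd x)) i j l \<noteq> 0)"
      by (simp add: p3_def Ball_def split_paired_All) blast
    ultimately show ?thesis by (simp add: p_def)
  qed
  have "real_polynomial_function p1" unfolding p1_def[abs_def]
    by (rule real_polynomial_function_prod[OF finite]) (rule real_polynomial_function_generic(1))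
  moreover have "real_polynomial_function p2" unfolding p2_def[abs_def]
    by (rule real_polynomial_function_prod[OF finite]) (rule real_polynomial_function_generic(2))
  ultimately have "real_polynomial_function (\<lambda>x. p1 x * p2 x)" by (rule real_polynomial_function.intros(4))
  moreover have "real_polynomial_function p3" unfolding p3_def[abs_def]
    by (rule real_polynomial_function_prod[OF finite]) (rule real_polynomial_function_generic(3))
  ultimately have "real_polynomial_function p"
    unfolding p_def[abs_def] by (rule real_polynomial_function.intros(4))
  then have "algebraic_subset {x. p x = 0}"
    unfolding algebraic_subset_def by (intro exI[of _ "{p}"]) simp
  moreover have "{x. p x = 0} \<noteq> UNIV"
  proof -
    obtain f :: "'n \<Rightarrow> nat" where "inj f" using finite_imp_inj_to_nat_seg[of "UNIV :: 'n set"] by auto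
    then have f: "real (f i) - real (f j) \<noteq> 0" if "i \<noteq> j" for i j using that by (auto simp: inj_def)
    \<comment> \<open>The lines f y_1 + y_2 = f^2, for distinct natural numbers f, are tangents of
      the parabola 4 y_2 = - y_1^2. Their concurrency determinants are Vandermonde products, and
      \<open>b\<close> = (1, 0) makes every \<open>cost_det\<close> equal to 1.\<close>
    define a :: "real^'n^2" where "a = vector [\<chi> i. real (f i), \<chi> i. 1]"
    define c :: "real^'n" where "c = (\<chi> i. (real (f i))\<^sup>2)"
    define b :: "real^2" where "b = vector [1, 0]"
    have a: "a $ 1 $ i = real (f i)" "a $ 2 $ i = 1" for i by (simp_all add: a_def)
    have b: "b $ 1 = 1" "b $ 2 = 0" by (simp_all add: b_def)
    have "line_det a i j = real (f i) - real (f j)" for i j by (simp add: line_det_def a)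
    moreover have "concurrency_det a c i j l
        = (real (f j) - real (f l)) * (real (f i) - real (f j)) * (real (f i) - real (f l))" for i j l
      unfolding concurrency_det_def line_det_def a c_def vec_lambda_beta
      by (simp add: algebra_simps power2_eq_square)
    ultimately have "p (a, c, b) \<noteq> 0"
      unfolding p using f by (auto simp: cost_det_def a b)
    then show ?thesis by blast
  qed
  moreover have "case x of (a, c, b) \<Rightarrow> average_total_curvature a c b \<le> ennreal (2 * pi)"
    if "x \<notin> {x. p x = 0}" for x
  proof -
    obtain a c b where x: "x = (a, c, b)" by (cases x)
    have "p (a, c, b) \<noteq> 0" using that unfolding x by simp
    then have "average_total_curvature a c b \<le> ennreal (2 * pi)"
      unfolding p by (intro average_total_curvature_le[OF assms]) simp_all
    then show ?thesis unfolding x by simp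
  qed
  ultimately show ?thesis unfolding generically_def by blast
qed

end
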